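(* The $7$ Kähler forms $\phi_i,\phi_j,\phi_k,\phi_e,\phi_f,\phi_g,\phi_h$ of the complex structures $R_i,\dots,R_h$ on $\mathbb{R}^8\cong\mathbb{O}$ and the $21$ Kähler forms $\varphi_{ij},\varphi_{ik},\dots,\varphi_{gh}$ of the complex structures $R_{\alpha\beta}=R_\alpha R_\beta$, for $\alpha<\beta$ in the ordered set $\{i,j,k,e,f,g,h\}$, satisfy $$\Phi_{\mathrm{Spin}(7)}=-\frac16\left(\phi_i^2+\dots+\phi_h^2\right)=\frac16\left(\varphi_{ij}^2+\varphi_{ik}^2+\dots+\varphi_{gh}^2\right)=\frac16\,\tau_2(\varphi),$$ where $\tau_2(\varphi)$ is the second coefficient of the characteristic polynomial of $\varphi=(\varphi_{\alpha\beta})$. Thus $\Phi_{\mathrm{Spin}(7)}$ is, up to a constant, the sum of squares of the elements of an orthonormal basis in any of the two components of the $\mathrm{Spin}(7)$-decomposition $\Lambda^2\mathbb{R}^8=\Lambda^2_7\oplus\Lambda^2_{21}$.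
   Context: Octonions: $\mathbb{O}=\mathbb{H}\oplus\mathbb{H}e$ with product $(h_1+h_2e)(h_1'+h_2'e)=(h_1h_1'-\overline{h_2'}h_2)+(h_2\overline{h_1'}+h_2'h_1)e$, real orthonormal basis $1,i,j,k,e,f=ie,g=je,h=ke$ giving coordinates $x_1,\dots,x_8$ on $\mathbb{R}^8$. $R_u$ denotes right multiplication $x\mapsto xu$. The Kähler form of an orthogonal complex structure $J$ is $\omega_J(X,Y)=\langle X,JY\rangle$. The skew-symmetric $7\times7$ matrix $\varphi=(\varphi_{\alpha\beta})$ has entries $\varphi_{\alpha\beta}$ = Kähler form of $R_\alpha R_\beta$ for $\alpha\neq\beta$, and $\varphi_{\alpha\alpha}=0$; $\tau_2(\varphi)$ is the coefficient of $t^5$ in $\det(tI-\varphi)$, computed in the commutative algebra of even forms; squares are wedge squares. With $abcd$ denoting $dx_a\wedge dx_b\wedge dx_c\wedge dx_d$ and $\star$ the Hodge star, $$\Phi_{\mathrm{Spin}(7)}=\eta+\star\eta,\qquad \eta=1234+1256+1357+1368-1278-1467+1458 .$$ $\mathrm{Spin}(7)\subset\mathrm{SO}(8)$ is the stabilizer of $\Phi_{\mathrm{Spin}(7)}$, equivalently the subgroup generated by the $R_u$ with $u$ a unit imaginary octonion. Under it $\Lambda^2\mathbb{R}^8=\Lambda^2_7\oplus\Lambda^2_{21}$ orthogonally into irreducible components of dimensions $7$ and $21$; $\Lambda^2_7$ is spanned by $\phi_i,\dots,\phi_h$ and $\Lambda^2_{21}\cong\mathfrak{spin}(7)$. *)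

theory Defs
  imports "HOL-Analysis.Analysis" "HOL-Computational_Algebra.Polynomial"
begin

section \<open>Quaternions and octonions\<close>

text \<open>Quaternions are \<^typ>\<open>real^4\<close> in the basis \<open>1,i,j,k\<close>, octonions are \<^typ>\<open>real^8\<close> in the basis
  \<open>1,i,j,k,e,f,g,h\<close>; the entries of \<^const>\<open>vector\<close> are the coordinates number \<open>1,2,3,\<dots>\<close>.\<close>

definition qmult :: "real^4 \<Rightarrow> real^4 \<Rightarrow> real^4" where
  "qmult p q = vector
    [p$1 * q$1 - p$2 * q$2 - p$3 * q$3 - p$4 * q$4,
     p$1 * q$2 + p$2 * q$1 + p$3 * q$4 - p$4 * q$3,
     p$1 * q$3 - p$2 * q$4 + p$3 * q$1 + p$4 * q$2,
     p$1 * q$4 + p$2 * q$3 - p$3 * q$2 + p$4 * q$1]"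

definition qcnj :: "real^4 \<Rightarrow> real^4" where
  "qcnj p = vector [p$1, - p$2, - p$3, - p$4]"

text \<open>The octonion \<open>h\<^sub>1 + h\<^sub>2 e\<close>, and the two quaternionic components of an octonion.\<close>

definition oct_of :: "real^4 \<Rightarrow> real^4 \<Rightarrow> real^8" where
  "oct_of p q = vector [p$1, p$2, p$3, p$4, q$1, q$2, q$3, q$4]"

definition oct_fst :: "real^8 \<Rightarrow> real^4" where
  "oct_fst x = vector [x$1, x$2, x$3, x$4]"

definition oct_snd :: "real^8 \<Rightarrow> real^4" where
  "oct_snd x = vector [x$5, x$6, x$7, x$8]"

definition omult :: "real^8 \<Rightarrow> real^8 \<Rightarrow> real^8" where
  "omult x y = oct_of
     (qmult (oct_fst x) (oct_fst y) - qmult (qcnj (oct_snd y)) (oct_snd x))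
     (qmult (oct_snd x) (qcnj (oct_fst y)) + qmult (oct_snd y) (oct_fst x))"

definition right_mult :: "real^8 \<Rightarrow> real^8 \<Rightarrow> real^8" where
  "right_mult u = (\<lambda>x. omult x u)"

datatype im_unit = Ui | Uj | Uk | Ue | Uf | Ug | Uh

lemma UNIV_im_unit: "UNIV = {Ui, Uj, Uk, Ue, Uf, Ug, Uh}"
  using im_unit.exhaust by auto

instance im_unit :: finite
  by standard (simp add: UNIV_im_unit)

fun unit_index :: "im_unit \<Rightarrow> nat" where
  "unit_index Ui = 2" | "unit_index Uj = 3" | "unit_index Uk = 4" | "unit_index Ue = 5"
| "unit_index Uf = 6" | "unit_index Ug = 7" | "unit_index Uh = 8"

definition unit_vec :: "im_unit \<Rightarrow> real^8" where
  "unit_vec \<alpha> = axis (of_nat (unit_index \<alpha>)) 1"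

abbreviation R :: "im_unit \<Rightarrow> real^8 \<Rightarrow> real^8" where
  "R \<alpha> \<equiv> right_mult (unit_vec \<alpha>)"


section \<open>The exterior algebra of \<open>\<real>\<^sup>8\<close>\<close>

text \<open>A form is given by its coefficients: \<open>a $ I\<close> is the coefficient of
  \<open>dx\<^sub>I = dx\<^bsub>i\<^sub>1\<^esub> \<and> \<dots> \<and> dx\<^bsub>i\<^sub>k\<^esub>\<close>, where \<open>I = {i\<^sub>1 < \<dots> < i\<^sub>k}\<close>. The inner product of
  \<^typ>\<open>real^(8 set)\<close> makes the \<open>dx\<^sub>I\<close> orthonormal.

  In the type \<^typ>\<open>8\<close> the numeral \<open>8\<close> equals \<open>0\<close> and is therefore the least element of the type.
  The coordinates are ordered as \<open>1 < 2 < \<dots> < 8\<close> instead, which is the order of the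
  predecessors in the type.\<close>

type_synonym form = "real^(8 set)"

definition coord_less :: "8 \<Rightarrow> 8 \<Rightarrow> bool" where
  "coord_less a b \<longleftrightarrow> a - 1 < b - 1"

text \<open>For disjoint \<open>S\<close> and \<open>T\<close>, \<open>dx\<^sub>S \<and> dx\<^sub>T\<close> equals \<open>dx\<^bsub>S \<union> T\<^esub>\<close> up to the sign
  of the permutation sorting the concatenation.\<close>

definition wsign :: "8 set \<Rightarrow> 8 set \<Rightarrow> real" where
  "wsign S T = (- 1) ^ card {(s, t). s \<in> S \<and> t \<in> T \<and> coord_less t s}"

definition wedge :: "form \<Rightarrow> form \<Rightarrow> form" (infixr "\<and>\<^sub>w" 70) where
  "a \<and>\<^sub>w b = (\<chi> U. \<Sum>S\<in>Pow U. wsign S (U - S) * (a $ S) * (b $ (U - S)))"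

definition dx :: "8 \<Rightarrow> form" where
  "dx a = axis {a} 1"

definition wedge_list :: "form list \<Rightarrow> form" where
  "wedge_list fs = foldr (\<and>\<^sub>w) fs (axis {} 1)"

definition dxs :: "8 list \<Rightarrow> form" where
  "dxs is = wedge_list (map dx is)"

text \<open>\<open>dx\<^sub>I \<and> \<star>dx\<^sub>I = dx\<^sub>1 \<and> \<dots> \<and> dx\<^sub>8\<close>.\<close>

definition hodge :: "form \<Rightarrow> form" where
  "hodge a = (\<chi> U. wsign (- U) U * (a $ (- U)))"

text \<open>The 2-form of an alternating bilinear map, and the Kaehler form \<open>\<omega>\<^sub>J(X, Y) = \<langle>X, J Y\<rangle>\<close>.\<close>

definition two_form :: "(real^8 \<Rightarrow> real^8 \<Rightarrow> real) \<Rightarrow> form" where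
  "two_form \<omega> = (\<Sum>(a, b)\<in>{(a, b). coord_less a b}. \<omega> (axis a 1) (axis b 1) *\<^sub>R (dx a \<and>\<^sub>w dx b))"

definition kaehler :: "(real^8 \<Rightarrow> real^8) \<Rightarrow> form" where
  "kaehler J = two_form (\<lambda>X Y. X \<bullet> J Y)"

definition pullback :: "real^8^8 \<Rightarrow> form \<Rightarrow> form" where
  "pullback A a = (\<Sum>I\<in>UNIV. (a $ I) *\<^sub>R
     wedge_list (map (\<lambda>i. \<Sum>j\<in>UNIV. (A $ i $ j) *\<^sub>R dx j)
       (filter (\<lambda>i. i \<in> I) [1, 2, 3, 4, 5, 6, 7, 8])))"


section \<open>The commutative ring of even forms\<close>

lemma finite_8 [simp]: "finite (S :: 8 set)"
  by simp

lemma wsign_finite: "finite {(s, t). s \<in> S \<and> t \<in> T \<and> coord_less t s}"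
  by (rule finite_subset[of _ "UNIV \<times> UNIV"]) auto

lemma wsign_Un_left:
  assumes "S \<inter> T = {}"
  shows "wsign (S \<union> T) U = wsign S U * wsign T U"
proof -
  have "{(s, t). s \<in> S \<union> T \<and> t \<in> U \<and> coord_less t s}
      = {(s, t). s \<in> S \<and> t \<in> U \<and> coord_less t s} \<union> {(s, t). s \<in> T \<and> t \<in> U \<and> coord_less t s}"
    by auto
  moreover have "{(s, t). s \<in> S \<and> t \<in> U \<and> coord_less t s}
      \<inter> {(s, t). s \<in> T \<and> t \<in> U \<and> coord_less t s} = {}"
    using assms by auto
  ultimately show ?thesis
    by (simp add: wsign_def card_Un_disjoint[OF wsign_finite wsign_finite] power_add)
qed

lemma wsign_Un_right:
  assumes "T \<inter> U = {}"
  shows "wsign S (T \<union> U) = wsign S T * wsign S U"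
proof -
  have "{(s, t). s \<in> S \<and> t \<in> T \<union> U \<and> coord_less t s}
      = {(s, t). s \<in> S \<and> t \<in> T \<and> coord_less t s} \<union> {(s, t). s \<in> S \<and> t \<in> U \<and> coord_less t s}"
    by auto
  moreover have "{(s, t). s \<in> S \<and> t \<in> T \<and> coord_less t s}
      \<inter> {(s, t). s \<in> S \<and> t \<in> U \<and> coord_less t s} = {}"
    using assms by auto
  ultimately show ?thesis
    by (simp add: wsign_def card_Un_disjoint[OF wsign_finite wsign_finite] power_add)
qed

lemma wsign_swap:
  assumes "S \<inter> T = {}"
  shows "wsign S T * wsign T S = (- 1) ^ (card S * card T)"
proof -
  let ?A = "{(s, t). s \<in> S \<and> t \<in> T \<and> coord_less t s}"
  let ?B = "{(s, t). s \<in> T \<and> t \<in> S \<and> coord_less t s}"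
  have neq: "coord_less s t \<longleftrightarrow> \<not> coord_less t s" if "s \<in> S" "t \<in> T" for s t
  proof -
    have "s - 1 \<noteq> t - 1" using that assms by auto
    then show ?thesis unfolding coord_less_def by (metis less_linear less_asym)
  qed
  have "card ?B = card (prod.swap ` ?B)"
    by (simp add: card_image)
  moreover have "card ?A + card (prod.swap ` ?B) = card (?A \<union> prod.swap ` ?B)"
    by (rule card_Un_disjoint[symmetric]) (use neq in \<open>auto simp: wsign_finite\<close>)
  moreover have "?A \<union> prod.swap ` ?B = S \<times> T"
    using neq by (force simp: image_iff)
  ultimately show ?thesis
    by (simp add: wsign_def card_cartesian_product flip: power_add)
qed

lemma wsign_sq [simp]: "wsign S T * wsign S T = 1"
  by (simp add: wsign_def flip: power_add)

lemma wsign_commute: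
  assumes "S \<inter> T = {}" "even (card S)"
  shows "wsign S T = wsign T S"
proof -
  have "wsign S T * wsign T S = 1" using wsign_swap[OF assms(1)] assms(2) by simp
  then have "wsign S T * (wsign T S * wsign T S) = wsign T S"
    by (metis mult.assoc mult_1)
  then show ?thesis by simp
qed

lemma wedge_assoc: "(a \<and>\<^sub>w b) \<and>\<^sub>w c = a \<and>\<^sub>w b \<and>\<^sub>w c"
proof (rule vec_eq_iff[THEN iffD2], rule allI)
  fix U :: "8 set"
  have "((a \<and>\<^sub>w b) \<and>\<^sub>w c) $ U
      = (\<Sum>(S, T)\<in>(SIGMA S:Pow U. Pow S).
          wsign S (U - S) * (wsign T (S - T) * a$T * b$(S - T)) * c$(U - S))"
    by (simp add: wedge_def sum_distrib_left sum_distrib_right sum.Sigma)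
  also have "\<dots> = (\<Sum>(T, Q)\<in>(SIGMA T:Pow U. Pow (U - T)).
          wsign T (U - T) * a$T * (wsign Q (U - T - Q) * b$Q * c$(U - T - Q)))"
  proof (rule sum.reindex_bij_witness[where i = "\<lambda>(T, Q). (T \<union> Q, T)"
        and j = "\<lambda>(S, T). (T, S - T)"], goal_cases)
    case (5 x)
    obtain S T where x: "x = (S, T)" by force
    with 5 have sub: "T \<subseteq> S" "S \<subseteq> U" by auto
    have eq: "U - T - (S - T) = U - S" using sub by auto
    have "wsign S (U - S) = wsign T (U - S) * wsign (S - T) (U - S)"
      using wsign_Un_left[of T "S - T" "U - S"] sub by (auto simp: Un_absorb1)
    moreover have "wsign T (U - T) = wsign T (S - T) * wsign T (U - S)"
    proof -
      have "U - T = (S - T) \<union> (U - S)" using sub by auto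
      then show ?thesis using wsign_Un_right[of "S - T" "U - S" T] by auto
    qed
    ultimately show ?case by (simp add: x eq)
  qed auto
  also have "\<dots> = (a \<and>\<^sub>w b \<and>\<^sub>w c) $ U"
    by (simp add: wedge_def sum_distrib_left sum.Sigma)
  finally show "((a \<and>\<^sub>w b) \<and>\<^sub>w c) $ U = (a \<and>\<^sub>w b \<and>\<^sub>w c) $ U" .
qed

lemma wedge_add_left: "(a + b) \<and>\<^sub>w c = a \<and>\<^sub>w c + b \<and>\<^sub>w c"
  by (simp add: vec_eq_iff wedge_def algebra_simps sum.distrib)

lemma wedge_one_left: "axis {} 1 \<and>\<^sub>w a = a"
proof (rule vec_eq_iff[THEN iffD2], rule allI)
  fix U :: "8 set"
  have "(axis {} 1 \<and>\<^sub>w a) $ U = (\<Sum>S\<in>Pow U. if S = {} then a $ U else 0)"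
  proof -
    have "wsign {} U = 1" by (simp add: wsign_def)
    then show ?thesis
      unfolding wedge_def vec_lambda_beta by (intro sum.cong) (auto simp: axis_def)
  qed
  then show "(axis {} 1 \<and>\<^sub>w a) $ U = a $ U" by simp
qed

definition even_forms :: "form set" where
  "even_forms = {a. \<forall>I. odd (card I) \<longrightarrow> a $ I = 0}"

lemma wedge_even_commute:
  assumes "a \<in> even_forms"
  shows "a \<and>\<^sub>w b = b \<and>\<^sub>w a"
proof (rule vec_eq_iff[THEN iffD2], rule allI)
  fix U :: "8 set"
  have "(\<Sum>S\<in>Pow U. wsign S (U - S) * a$S * b$(U - S))
      = (\<Sum>S\<in>Pow U. wsign S (U - S) * b$S * a$(U - S))"
  proof (rule sum.reindex_bij_witness[where i = "\<lambda>S. U - S" and j = "\<lambda>S. U - S"], goal_cases)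
    case (5 S)
    then have eq: "U - (U - S) = S" by auto
    show ?case
    proof (cases "even (card S)")
      case True
      then show ?thesis using wsign_commute[of S "U - S"] by (simp add: eq)
    next
      case False
      then have "a $ S = 0" using assms by (simp add: even_forms_def)
      then show ?thesis by (simp add: eq)
    qed
  qed auto
  then show "(a \<and>\<^sub>w b) $ U = (b \<and>\<^sub>w a) $ U" by (simp add: wedge_def)
qed

lemma wedge_even:
  assumes "a \<in> even_forms" "b \<in> even_forms"
  shows "a \<and>\<^sub>w b \<in> even_forms"
proof -
  have "(a \<and>\<^sub>w b) $ U = 0" if "odd (card U)" for U
  proof -
    have "a $ S = 0 \<or> b $ (U - S) = 0" if "S \<subseteq> U" for S
    proof -
      have "card U = card S + card (U - S)"
        using that by (simp add: card_Diff_subset card_mono)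
      with \<open>odd (card U)\<close> have "odd (card S) \<or> odd (card (U - S))" by auto
      then show ?thesis using assms by (auto simp: even_forms_def)
    qed
    then show ?thesis unfolding wedge_def by (auto intro!: sum.neutral)
  qed
  then show ?thesis by (simp add: even_forms_def)
qed

lemma wedge_odd_odd:
  assumes "\<And>I. even (card I) \<Longrightarrow> a $ I = 0" "\<And>I. even (card I) \<Longrightarrow> b $ I = 0"
  shows "a \<and>\<^sub>w b \<in> even_forms"
proof -
  have "(a \<and>\<^sub>w b) $ U = 0" if "odd (card U)" for U
  proof -
    have "a $ S = 0 \<or> b $ (U - S) = 0" if "S \<subseteq> U" for S
    proof -
      have "card U = card S + card (U - S)"
        using that by (simp add: card_Diff_subset card_mono)
      with \<open>odd (card U)\<close> have "even (card S) \<or> even (card (U - S))" by auto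
      then show ?thesis using assms by auto
    qed
    then show ?thesis unfolding wedge_def by (auto intro!: sum.neutral)
  qed
  then show ?thesis by (simp add: even_forms_def)
qed

lemma subspace_even_forms: "subspace even_forms"
  by (auto simp: even_forms_def subspace_def)

lemma kaehler_even: "kaehler J \<in> even_forms"
proof -
  have "dx a \<and>\<^sub>w dx b \<in> even_forms" for a b
    by (rule wedge_odd_odd) (auto simp: dx_def axis_def)
  then show ?thesis
    unfolding kaehler_def two_form_def
    by (auto intro!: subspace_sum[OF subspace_even_forms] subspace_scale[OF subspace_even_forms])
qed

typedef even_form = even_forms
  using subspace_even_forms subspace_0 by blast

setup_lifting type_definition_even_form

instantiation even_form :: comm_ring_1
begin

lift_definition zero_even_form :: even_form is 0
  by (simp add: even_forms_def)

lift_definition one_even_form :: even_form is "axis {} 1"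
  by (auto simp: even_forms_def axis_def)

lift_definition plus_even_form :: "even_form \<Rightarrow> even_form \<Rightarrow> even_form" is "(+)"
  by (simp add: even_forms_def)

lift_definition minus_even_form :: "even_form \<Rightarrow> even_form \<Rightarrow> even_form" is "(-)"
  by (simp add: even_forms_def)

lift_definition uminus_even_form :: "even_form \<Rightarrow> even_form" is uminus
  by (simp add: even_forms_def)

lift_definition times_even_form :: "even_form \<Rightarrow> even_form \<Rightarrow> even_form" is "(\<and>\<^sub>w)"
  by (rule wedge_even)

instance
proof
  show "(0 :: even_form) \<noteq> 1"
    by transfer (auto simp: vec_eq_iff axis_def)
qed (transfer; simp add: wedge_assoc wedge_add_left wedge_one_left wedge_even_commute)+

end

lift_definition even_kaehler :: "(real^8 \<Rightarrow> real^8) \<Rightarrow> even_form" is kaehler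
  by (rule kaehler_even)


section \<open>The forms \<open>\<phi>\<^sub>\<alpha>\<close>, the matrix \<open>\<phi> = (\<phi>\<^sub>\<alpha>\<^sub>\<beta>)\<close> and \<open>\<Phi>\<close>\<close>

definition phi1 :: "im_unit \<Rightarrow> form" where
  "phi1 \<alpha> = kaehler (R \<alpha>)"

definition phi2 :: "im_unit \<Rightarrow> im_unit \<Rightarrow> form" where
  "phi2 \<alpha> \<beta> = kaehler (R \<alpha> \<circ> R \<beta>)"

definition phi_matrix :: "even_form^im_unit^im_unit" where
  "phi_matrix = (\<chi> \<alpha> \<beta>. if \<alpha> = \<beta> then 0 else even_kaehler (R \<alpha> \<circ> R \<beta>))"

definition charpoly :: "'a::comm_ring_1^'n^'n \<Rightarrow> 'a poly" where
  "charpoly M = det (mat [:0, 1:] - map_matrix (\<lambda>c. [:c:]) M)"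

definition tau2 :: "even_form^im_unit^im_unit \<Rightarrow> even_form" where
  "tau2 M = coeff (charpoly M) 5"

definition eta_Spin7 :: form where
  "eta_Spin7 = dxs [1,2,3,4] + dxs [1,2,5,6] + dxs [1,3,5,7] + dxs [1,3,6,8]
     - dxs [1,2,7,8] - dxs [1,4,6,7] + dxs [1,4,5,8]"

definition Phi_Spin7 :: form where
  "Phi_Spin7 = eta_Spin7 + hodge eta_Spin7"


section \<open>The \<open>Spin(7)\<close>-decomposition of the 2-forms\<close>

definition Spin7 :: "(real^8^8) set" where
  "Spin7 = {A. rotation_matrix A \<and> pullback A Phi_Spin7 = Phi_Spin7}"

definition Lambda2 :: "form set" where
  "Lambda2 = {a. \<forall>I. card I \<noteq> 2 \<longrightarrow> a $ I = 0}"

definition Spin7_invariant :: "form set \<Rightarrow> bool" where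
  "Spin7_invariant V \<longleftrightarrow> subspace V \<and> (\<forall>A\<in>Spin7. \<forall>v\<in>V. pullback A v \<in> V)"

definition Spin7_irreducible :: "form set \<Rightarrow> bool" where
  "Spin7_irreducible V \<longleftrightarrow> Spin7_invariant V \<and> V \<noteq> {0} \<and>
     (\<forall>W. Spin7_invariant W \<and> W \<subseteq> V \<longrightarrow> W = {0} \<or> W = V)"

definition Spin7_decomposition :: "form set \<Rightarrow> form set \<Rightarrow> bool" where
  "Spin7_decomposition V7 V21 \<longleftrightarrow>
     Spin7_irreducible V7 \<and> Spin7_irreducible V21 \<and> dim V7 = 7 \<and> dim V21 = 21 \<and>
     (\<forall>v\<in>V7. \<forall>w\<in>V21. orthogonal v w) \<and> {v + w |v w. v \<in> V7 \<and> w \<in> V21} = Lambda2"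

definition orthonormal_basis :: "form set \<Rightarrow> form set \<Rightarrow> bool" where
  "orthonormal_basis V B \<longleftrightarrow>
     B \<subseteq> V \<and> span B = V \<and> pairwise orthogonal B \<and> (\<forall>b\<in>B. norm b = 1)"

end

theory Submission
  imports Defs
begin

text \<open>
  The two sums of squares are finite computations: each \<open>R\<^sub>\<alpha>\<close> is a signed permutation of the
  basis. The matrix \<open>\<phi>\<close> is skew with zero diagonal, and only transpositions contribute to the
  second coefficient of its characteristic polynomial, which is therefore the sum of the squares.

  For the last claim, \<open>\<Phi> \<and> w \<and> w = (|w|\<^sup>2 - \<Sum>\<^sub>\<alpha> \<langle>w, \<phi>\<^sub>\<alpha>\<rangle>\<^sup>2) vol\<close> for every 2-form \<open>w\<close>. An element
  of \<open>Spin(7)\<close> preserves \<open>\<Phi>\<close>, the norm and \<open>vol = \<Phi>\<^sup>2 / 14\<close>, so the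
  orthogonal complement of the \<open>\<phi>\<^sub>\<alpha>\<close> is invariant. By dimension it meets \<open>V21\<close>, hence contains
  it, and \<open>V7\<close> is the span of the \<open>\<phi>\<^sub>\<alpha>\<close>. A sum \<open>\<Sum> b \<and> b\<close> over an orthonormal basis
  depends only on the space it spans, and over a basis of all 2-forms it vanishes, so the sums for
  \<open>V7\<close> and \<open>V21\<close> are opposite.
\<close>

section \<open>Computing with forms\<close>

text \<open>The index n stands for coordinate number n + 1. Subtracting 1 in the type gives
  \<open>of_nat n\<close>, so below 8 the order \<open>coord_less\<close> becomes the usual order of
  naturals, even for \<open>cx 7\<close>, which is 0 in the type.\<close>

definition cx :: "nat \<Rightarrow> 8" where
  "cx n = of_nat (Suc n)"

lemma less_of_nat_8: "m < 8 \<Longrightarrow> n < 8 \<Longrightarrow> (of_nat m :: 8) < of_nat n \<longleftrightarrow> m < n"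
  by (simp add: less_bit0_def bit0.of_nat_eq bit0.Abs_inverse Abs_bit0_inverse)

lemma coord_less_cx: "m < 8 \<Longrightarrow> n < 8 \<Longrightarrow> coord_less (cx m) (cx n) \<longleftrightarrow> m < n"
  using less_of_nat_8 by (simp add: coord_less_def cx_def)

lemma coord_less_linear: "coord_less a b \<or> a = b \<or> coord_less b a"
  unfolding coord_less_def by (metis diff_add_cancel less_linear)

lemma coord_less_asym: "coord_less a b \<Longrightarrow> \<not> coord_less b a"
  by (simp add: coord_less_def)

lemma coord_less_irrefl [simp]: "\<not> coord_less a a"
  by (simp add: coord_less_def)

lemma inj_on_cx: "inj_on cx {..<8}"
  by (rule linorder_inj_onI) (metis coord_less_cx coord_less_irrefl lessThan_iff, auto)

lemma cx_eq_iff: "m < 8 \<Longrightarrow> n < 8 \<Longrightarrow> cx m = cx n \<longleftrightarrow> m = n"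
  using inj_on_cx by (auto simp: inj_on_def)

lemma UNIV_8: "(UNIV :: 8 set) = cx ` {..<8}"
  by (rule card_subset_eq[symmetric]) (simp_all add: card_image[OF inj_on_cx])

lemma numeral_8_cx:
  "(1 :: 8) = cx 0" "(2 :: 8) = cx 1" "(3 :: 8) = cx 2" "(4 :: 8) = cx 3"
  "(5 :: 8) = cx 4" "(6 :: 8) = cx 5" "(7 :: 8) = cx 6" "(8 :: 8) = cx 7"
  by (simp_all add: cx_def)

section \<open>Products of basis monomials and bilinearity of the wedge\<close>

lemma wedge_axis:
  "axis S 1 \<and>\<^sub>w axis T 1 = (if S \<inter> T = {} then wsign S T *\<^sub>R axis (S \<union> T) 1 else 0)"
proof (rule vec_eq_iff[THEN iffD2], rule allI)
  fix U :: "8 set"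
  have "(axis S 1 \<and>\<^sub>w axis T 1) $ U
      = (\<Sum>S'\<in>Pow U. if S' = S then (if T = U - S then wsign S T else 0) else 0)"
    unfolding wedge_def vec_lambda_beta by (intro sum.cong) (auto simp: axis_def)
  also have "\<dots> = (if S \<subseteq> U \<and> T = U - S then wsign S T else 0)"
    by simp
  also have "S \<subseteq> U \<and> T = U - S \<longleftrightarrow> S \<inter> T = {} \<and> U = S \<union> T"
    by auto
  finally show "(axis S 1 \<and>\<^sub>w axis T 1) $ U
      = (if S \<inter> T = {} then wsign S T *\<^sub>R axis (S \<union> T) 1 else 0) $ U"
    by (auto simp: axis_def)
qed

lemma wedge_scaleR_left: "(k *\<^sub>R a) \<and>\<^sub>w b = k *\<^sub>R (a \<and>\<^sub>w b)"
  by (simp add: vec_eq_iff wedge_def algebra_simps sum_distrib_left)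

lemma wedge_scaleR_right: "a \<and>\<^sub>w (k *\<^sub>R b) = k *\<^sub>R (a \<and>\<^sub>w b)"
  by (simp add: vec_eq_iff wedge_def algebra_simps sum_distrib_left)

lemma wedge_add_right: "a \<and>\<^sub>w (b + c) = a \<and>\<^sub>w b + a \<and>\<^sub>w c"
  by (simp add: vec_eq_iff wedge_def algebra_simps sum.distrib)

lemma bilinear_wedge: "bilinear (\<and>\<^sub>w)"
  unfolding bilinear_def
  by (auto intro!: linearI simp: wedge_add_left wedge_add_right wedge_scaleR_left wedge_scaleR_right)

lemmas wedge_zero_left = bilinear_lzero[OF bilinear_wedge]
lemmas wedge_zero_right = bilinear_rzero[OF bilinear_wedge]
lemmas wedge_minus_left = bilinear_lneg[OF bilinear_wedge]

lemma wedge_sum_left: "(\<Sum>i\<in>I. f i) \<and>\<^sub>w b = (\<Sum>i\<in>I. f i \<and>\<^sub>w b)"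
  by (induction I rule: infinite_finite_induct) (simp_all add: wedge_add_left wedge_zero_left)

lemma wedge_sum_right: "a \<and>\<^sub>w (\<Sum>i\<in>I. f i) = (\<Sum>i\<in>I. a \<and>\<^sub>w f i)"
  by (induction I rule: infinite_finite_induct) (simp_all add: wedge_add_right wedge_zero_right)

text \<open>A list of pairs \<open>(k, [n\<^sub>1, \<dots>, n\<^sub>r])\<close> stands for the form with terms
  \<open>k dx\<^bsub>{n\<^sub>1 + 1, \<dots>, n\<^sub>r + 1}\<^esub>\<close>, so that identities between explicit forms can be
  decided by evaluating \<open>fwedge\<close> and \<open>fcoeff\<close>.\<close>

definition form_of :: "(int \<times> nat list) list \<Rightarrow> form" where
  "form_of l = (\<Sum>(k, xs)\<leftarrow>l. of_int k *\<^sub>R axis (cx ` set xs) 1)"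

text \<open>Sortedness is not demanded: \<open>form_of\<close> sees only the set of indices, and
  \<open>isgn\<close> compares entries of two different lists, so the order inside each list has no
  effect on it.\<close>

definition valid_monom :: "nat list \<Rightarrow> bool" where
  "valid_monom xs \<longleftrightarrow> distinct xs \<and> (\<forall>x\<in>set xs. x < 8)"

definition valid_form :: "(int \<times> nat list) list \<Rightarrow> bool" where
  "valid_form l \<longleftrightarrow> (\<forall>(k, xs)\<in>set l. valid_monom xs)"

definition isgn :: "nat list \<Rightarrow> nat list \<Rightarrow> int" where
  "isgn xs ys = (\<Prod>x\<leftarrow>xs. \<Prod>y\<leftarrow>ys. if y < x then - 1 else 1)"

text \<open>The product is sorted so that monomials with the same indices are the same list, as
  \<open>fcoeff\<close> compares lists. The empty list is the zero form, the value when an index is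
  repeated.\<close>

definition mwedge :: "int \<times> nat list \<Rightarrow> int \<times> nat list \<Rightarrow> (int \<times> nat list) list" where
  "mwedge p q = (if list_all (\<lambda>x. \<not> List.member (snd q) x) (snd p)
     then [(fst p * fst q * isgn (snd p) (snd q), sort (snd p @ snd q))] else [])"

definition fwedge :: "(int \<times> nat list) list \<Rightarrow> (int \<times> nat list) list \<Rightarrow> (int \<times> nat list) list" where
  "fwedge l m = concat (map (\<lambda>p. concat (map (mwedge p) m)) l)"

definition fcoeff :: "(int \<times> nat list) list \<Rightarrow> nat list \<Rightarrow> int" where
  "fcoeff l ys = (\<Sum>(k, xs)\<leftarrow>l. if xs = ys then k else 0)"

definition fscale :: "int \<Rightarrow> (int \<times> nat list) list \<Rightarrow> (int \<times> nat list) list" where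
  "fscale c l = map (\<lambda>(k, xs). (c * k, xs)) l"

text \<open>Lists that occur on neither side have coefficient 0 on both, so a finite check suffices.
  The test is sufficient for equality of the forms: differently ordered lists count as
  different.\<close>

definition form_eq :: "(int \<times> nat list) list \<Rightarrow> (int \<times> nat list) list \<Rightarrow> bool" where
  "form_eq l m \<longleftrightarrow> list_all (\<lambda>ys. fcoeff l ys = fcoeff m ys) (remdups (map snd (l @ m)))"

section \<open>Correctness of the calculus on lists\<close>

lemma form_of_Nil [simp]: "form_of [] = 0"
  and form_of_Cons: "form_of ((k, xs) # l) = of_int k *\<^sub>R axis (cx ` set xs) 1 + form_of l"
  and form_of_append: "form_of (l @ m) = form_of l + form_of m"
  by (simp_all add: form_of_def)

lemma form_of_concat: "form_of (concat ls) = (\<Sum>l\<leftarrow>ls. form_of l)"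
  by (induction ls) (simp_all add: form_of_append)

lemma form_of_fscale: "form_of (fscale c l) = of_int c *\<^sub>R form_of l"
  by (induction l) (auto simp: fscale_def form_of_Cons scaleR_add_right)

text \<open>Like terms are collected. The index set \<open>K\<close> may exceed the monomials of
  \<open>l\<close>, so that two lists can be expanded over a common set and compared
  termwise.\<close>

lemma form_of_fcoeff:
  assumes "set (map snd l) \<subseteq> K" "finite K"
  shows "form_of l = (\<Sum>ys\<in>K. of_int (fcoeff l ys) *\<^sub>R axis (cx ` set ys) 1)"
  using assms(1)
proof (induction l)
  case Nil
  then show ?case by (simp add: fcoeff_def)
next
  case (Cons p l)
  obtain k xs where p: "p = (k, xs)" by force
  have "(\<Sum>ys\<in>K. of_int (fcoeff (p # l) ys) *\<^sub>R axis (cx ` set ys) 1) =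
    (\<Sum>ys\<in>K. (if ys = xs then of_int k *\<^sub>R axis (cx ` set ys) 1 else 0) +
       of_int (fcoeff l ys) *\<^sub>R axis (cx ` set ys) (1::real))"
    by (intro sum.cong) (auto simp: fcoeff_def p scaleR_add_left)
  with Cons \<open>finite K\<close> show ?case
    by (simp add: sum.distrib p form_of_Cons)
qed

lemma form_of_eqI: "form_eq l m \<Longrightarrow> form_of l = form_of m"
  using form_of_fcoeff[of l "set (map snd (l @ m))"] form_of_fcoeff[of m "set (map snd (l @ m))"]
  by (auto simp: form_eq_def list_all_iff intro!: sum.cong)

lemma wsign_empty [simp]: "wsign {} T = 1" "wsign S {} = 1"
  by (simp_all add: wsign_def)

lemma wsign_singleton: "wsign {a} {b} = (if coord_less b a then - 1 else 1)"
proof -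
  have "{(s, t). s \<in> {a} \<and> t \<in> {b} \<and> coord_less t s} = (if coord_less b a then {(a, b)} else {})"
    by auto
  then show ?thesis by (simp add: wsign_def)
qed

lemma wsign_insert_left: "a \<notin> S \<Longrightarrow> wsign (insert a S) T = wsign {a} T * wsign S T"
  using wsign_Un_left[of "{a}" S T] by simp

lemma wsign_insert_right: "b \<notin> T \<Longrightarrow> wsign S (insert b T) = wsign S {b} * wsign S T"
  using wsign_Un_right[of "{b}" T S] by simp

text \<open>Both signs are multiplicative in each argument over disjoint unions, so two inductions
  reduce the claim to single indices, where \<open>coord_less_cx\<close> applies.\<close>

lemma wsign_cx:
  assumes "valid_monom xs" "valid_monom ys"
  shows "wsign (cx ` set xs) (cx ` set ys) = of_int (isgn xs ys)"
proof -
  have 1: "wsign {cx x} (cx ` set ys) = of_int (\<Prod>y\<leftarrow>ys. if y < x then - 1 else 1)"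
    if "x < 8" for x
    using assms(2)
  proof (induction ys)
    case (Cons y ys)
    then have "cx y \<notin> cx ` set ys" by (auto simp: valid_monom_def cx_eq_iff)
    with Cons that show ?case
      by (auto simp: wsign_insert_right[where T = "cx ` set ys"] wsign_singleton coord_less_cx valid_monom_def)
  qed simp
  show ?thesis
    using assms(1)
  proof (induction xs)
    case (Cons x xs)
    then have "cx x \<notin> cx ` set xs" by (auto simp: valid_monom_def cx_eq_iff)
    with Cons show ?case
      by (auto simp: wsign_insert_left[where S = "cx ` set xs"] 1 valid_monom_def isgn_def)
  qed (simp add: isgn_def)
qed

lemma form_of_mwedge:
  assumes "valid_monom xs" "valid_monom ys"
  shows "form_of (mwedge (k, xs) (l, ys)) =
    (of_int k *\<^sub>R axis (cx ` set xs) 1) \<and>\<^sub>w (of_int l *\<^sub>R axis (cx ` set ys) 1)"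
proof -
  have "cx ` set xs \<inter> cx ` set ys = {} \<longleftrightarrow> set xs \<inter> set ys = {}"
    using assms by (auto simp: valid_monom_def cx_eq_iff)
  moreover have "list_all (\<lambda>x. \<not> List.member ys x) xs \<longleftrightarrow> set xs \<inter> set ys = {}"
    by (auto simp: list_all_iff)
  ultimately show ?thesis
    using wsign_cx[OF assms]
    by (simp add: mwedge_def form_of_Cons wedge_scaleR_left wedge_scaleR_right wedge_axis image_Un)
qed

lemma form_of_fwedge:
  assumes "valid_form l" "valid_form m"
  shows "form_of (fwedge l m) = form_of l \<and>\<^sub>w form_of m"
proof -
  have 1: "form_of (concat (map (mwedge (k, xs)) m)) =
    (of_int k *\<^sub>R axis (cx ` set xs) 1) \<and>\<^sub>w form_of m" if "valid_monom xs" for k xs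
    using assms(2)
  proof (induction m)
    case (Cons q m)
    obtain l ys where q: "q = (l, ys)" by force
    with Cons that show ?case
      by (simp add: form_of_append form_of_mwedge form_of_Cons wedge_add_right valid_form_def)
  qed (simp add: wedge_zero_right)
  show ?thesis
    using assms(1)
  proof (induction l)
    case (Cons q l)
    then show ?case
      by (cases q) (simp add: fwedge_def form_of_append 1 form_of_Cons wedge_add_left valid_form_def)
  qed (simp add: wedge_zero_left fwedge_def)
qed

lemma valid_form_fwedge: "valid_form l \<Longrightarrow> valid_form m \<Longrightarrow> valid_form (fwedge l m)"
  by (fastforce simp: valid_form_def fwedge_def mwedge_def valid_monom_def list_all_iff split: if_splits)

section \<open>Kaehler forms of signed permutations\<close>

lemma vector_8:
  "(vector [a, b, c, d, e, f, g, h] :: 'a::zero^8) $ 1 = a"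
  "(vector [a, b, c, d, e, f, g, h] :: 'a::zero^8) $ 2 = b"
  "(vector [a, b, c, d, e, f, g, h] :: 'a::zero^8) $ 3 = c"
  "(vector [a, b, c, d, e, f, g, h] :: 'a::zero^8) $ 4 = d"
  "(vector [a, b, c, d, e, f, g, h] :: 'a::zero^8) $ 5 = e"
  "(vector [a, b, c, d, e, f, g, h] :: 'a::zero^8) $ 6 = f"
  "(vector [a, b, c, d, e, f, g, h] :: 'a::zero^8) $ 7 = g"
  "(vector [a, b, c, d, e, f, g, h] :: 'a::zero^8) $ 8 = h"
  unfolding vector_def by simp_all

lemma vector_4:
  "(vector [a, b, c, d] :: 'a::zero^4) $ 1 = a"
  "(vector [a, b, c, d] :: 'a::zero^4) $ 2 = b"
  "(vector [a, b, c, d] :: 'a::zero^4) $ 3 = c"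
  "(vector [a, b, c, d] :: 'a::zero^4) $ 4 = d"
  unfolding vector_def by simp_all

text \<open>A table \<open>[(s\<^sub>0, p\<^sub>0), \<dots>, (s\<^sub>7, p\<^sub>7)]\<close> stands for the signed permutation matrix
  whose row \<open>a\<close> has the single entry \<open>s\<^sub>a\<close>, in column \<open>p\<^sub>a\<close>.\<close>

definition acts_as :: "(int \<times> nat) list \<Rightarrow> (real^8 \<Rightarrow> real^8) \<Rightarrow> bool" where
  "acts_as T J \<longleftrightarrow>
    (\<forall>x. \<forall>a<8. J x $ cx a = of_int (fst (T ! a)) * x $ cx (snd (T ! a)) \<and> snd (T ! a) < 8)"

fun unit_table :: "im_unit \<Rightarrow> (int \<times> nat) list" where
  "unit_table Ui = [(-1, 1), (1, 0), (1, 3), (-1, 2), (1, 5), (-1, 4), (-1, 7), (1, 6)]"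
| "unit_table Uj = [(-1, 2), (-1, 3), (1, 0), (1, 1), (1, 6), (1, 7), (-1, 4), (-1, 5)]"
| "unit_table Uk = [(-1, 3), (1, 2), (-1, 1), (1, 0), (1, 7), (-1, 6), (1, 5), (-1, 4)]"
| "unit_table Ue = [(-1, 4), (-1, 5), (-1, 6), (-1, 7), (1, 0), (1, 1), (1, 2), (1, 3)]"
| "unit_table Uf = [(-1, 5), (1, 4), (-1, 7), (1, 6), (-1, 1), (1, 0), (-1, 3), (1, 2)]"
| "unit_table Ug = [(-1, 6), (1, 7), (1, 4), (-1, 5), (-1, 2), (1, 3), (1, 0), (-1, 1)]"
| "unit_table Uh = [(-1, 7), (-1, 6), (1, 5), (1, 4), (-1, 3), (-1, 2), (1, 1), (1, 0)]"

text \<open>In the composition the table \<open>S\<close> belongs to the map applied last: its row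
  is read first, and the column found there selects the row of \<open>T\<close>.\<close>

definition comp_table :: "(int \<times> nat) list \<Rightarrow> (int \<times> nat) list \<Rightarrow> (int \<times> nat) list" where
  "comp_table S T = map (\<lambda>(s, p). (s * fst (T ! p), snd (T ! p))) S"

lemma less_8_iff: "a < 8 \<longleftrightarrow> a = 0 \<or> a = 1 \<or> a = 2 \<or> a = 3 \<or> a = 4 \<or> a = 5 \<or> a = 6 \<or> a = (7 :: nat)"
  by auto

lemma acts_as_unit_table: "acts_as (unit_table \<alpha>) (R \<alpha>)"
  unfolding acts_as_def less_8_iff
  \<comment> \<open>The simplifier turns \<open>cx 1\<close> into \<open>cx (Suc 0)\<close>, so both
    shapes are needed to get back to numerals, to which \<open>vector_8\<close> and
    \<open>vector_4\<close> apply.\<close>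
  by (cases \<alpha>; simp flip: numeral_8_cx numeral_8_cx(2)[unfolded One_nat_def]
      add: right_mult_def omult_def oct_of_def oct_fst_def oct_snd_def qmult_def qcnj_def
        unit_vec_def vector_8 vector_4 axis_def)

lemma acts_as_comp_table:
  assumes "acts_as S J" "acts_as T K" "length S = 8"
  shows "acts_as (comp_table S T) (J \<circ> K)"
  using assms by (auto simp: acts_as_def comp_table_def case_prod_beta)

definition pairs8 :: "(nat \<times> nat) list" where
  "pairs8 = concat (map (\<lambda>a. map (\<lambda>b. (a, b)) [Suc a..<8]) [0..<8])"

lemma set_pairs8: "set pairs8 = {(a, b). a < b \<and> b < 8}"
  by (force simp: pairs8_def image_iff)

lemma distinct_pairs8: "distinct pairs8"
  by code_simp

lemma sum_coord_less:
  "(\<Sum>(a, b)\<in>{(a, b). coord_less a b}. f a b) = (\<Sum>(m, n)\<leftarrow>pairs8. f (cx m) (cx n))"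
proof -
  have "{(a, b). coord_less a b} = map_prod cx cx ` set pairs8"
  proof -
    have "p \<in> map_prod cx cx ` set pairs8" if less: "coord_less (fst p) (snd p)" for p
    proof -
      obtain m n where mn: "fst p = cx m" "snd p = cx n" "m < 8" "n < 8"
        using UNIV_8 by (metis UNIV_I imageE lessThan_iff)
      with less have "m < n" by (simp add: coord_less_cx)
      with mn show ?thesis
        by (intro image_eqI[where x = "(m, n)"]) (auto simp: set_pairs8 prod_eq_iff)
    qed
    moreover have "coord_less (cx m) (cx n)" if "(m, n) \<in> set pairs8" for m n
      using that by (auto simp: set_pairs8 coord_less_cx)
    ultimately show ?thesis by auto
  qed
  moreover have "inj_on (map_prod cx cx) (set pairs8)"
    by (auto simp: inj_on_def set_pairs8 cx_eq_iff)
  ultimately show ?thesis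
    by (simp add: sum.reindex sum.distinct_set_conv_list[OF distinct_pairs8, symmetric] case_prod_beta)
qed

text \<open>The matrix entry in row \<open>a\<close> and column \<open>b\<close>. For a < b it is
  also the coefficient of the Kaehler form at the corresponding monomial.\<close>

definition table_coeff :: "(int \<times> nat) list \<Rightarrow> nat \<Rightarrow> nat \<Rightarrow> int" where
  "table_coeff T a b = (if snd (T ! a) = b then fst (T ! a) else 0)"

text \<open>Zero terms are dropped to keep the evaluations short; \<open>form_of_filter\<close>
  shows that the form is unchanged.\<close>

definition table_form :: "(int \<times> nat) list \<Rightarrow> (int \<times> nat list) list" where
  "table_form T = filter (\<lambda>(k, _). k \<noteq> 0) (map (\<lambda>(a, b). (table_coeff T a b, [a, b])) pairs8)"

lemma valid_monom_pair: "a < b \<Longrightarrow> b < 8 \<Longrightarrow> valid_monom [a, b]"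
  by (simp add: valid_monom_def)

lemma valid_table_form: "valid_form (table_form T)"
  by (auto simp: valid_form_def table_form_def set_pairs8 valid_monom_pair)

lemma dx_wedge_dx: "dx a \<and>\<^sub>w dx b = (if a = b then 0 else wsign {a} {b} *\<^sub>R axis {a, b} 1)"
  by (simp add: dx_def wedge_axis insert_commute)

lemma form_of_filter: "form_of (filter (\<lambda>(k, _). k \<noteq> 0) l) = form_of l"
  by (induction l) (auto simp: form_of_Cons)

lemma form_of_map: "form_of (map (\<lambda>x. (f x, g x)) l) = (\<Sum>x\<leftarrow>l. of_int (f x) *\<^sub>R axis (cx ` set (g x)) 1)"
  by (simp add: form_of_def comp_def)

text \<open>The inner product of basis vector m with the image of basis vector n is coordinate m of
  that image, which is a table entry. Skewness of \<open>J\<close> plays no part in this, as the sum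
  defining \<open>two_form\<close> runs over ordered pairs only.\<close>

lemma kaehler_table:
  assumes "acts_as T J"
  shows "kaehler J = form_of (table_form T)"
proof -
  have "(\<lambda>(m, n). (axis (cx m) 1 \<bullet> J (axis (cx n) 1)) *\<^sub>R (dx (cx m) \<and>\<^sub>w dx (cx n))) p
      = (\<lambda>(m, n). of_int (table_coeff T m n) *\<^sub>R axis (cx ` set [m, n]) 1) p" if "p \<in> set pairs8" for p
  proof -
    obtain m n where p: "p = (m, n)" "m < n" "n < 8"
      using \<open>p \<in> set pairs8\<close> by (auto simp: set_pairs8)
    then have "dx (cx m) \<and>\<^sub>w dx (cx n) = axis (cx ` set [m, n]) 1"
      using coord_less_asym[of "cx m" "cx n"]
      by (simp add: dx_wedge_dx cx_eq_iff wsign_singleton coord_less_cx)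
    moreover have "axis (cx m) 1 \<bullet> J (axis (cx n) 1) = of_int (table_coeff T m n)"
      using assms p by (simp add: inner_axis' acts_as_def table_coeff_def cx_eq_iff) (simp add: axis_def cx_eq_iff)
    ultimately show ?thesis by (simp add: p)
  qed
  then show ?thesis
    unfolding kaehler_def two_form_def sum_coord_less table_form_def form_of_filter case_prod_beta
      form_of_map by (intro arg_cong[where f = sum_list] map_cong) auto
qed

section \<open>The forms of the theorem as explicit lists\<close>

abbreviation phi1_list :: "im_unit \<Rightarrow> (int \<times> nat list) list" where
  "phi1_list \<alpha> \<equiv> table_form (unit_table \<alpha>)"

abbreviation phi2_list :: "im_unit \<Rightarrow> im_unit \<Rightarrow> (int \<times> nat list) list" where
  "phi2_list \<alpha> \<beta> \<equiv> table_form (comp_table (unit_table \<alpha>) (unit_table \<beta>))"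

lemma length_unit_table [simp]: "length (unit_table \<alpha>) = 8"
  by (cases \<alpha>) simp_all

lemma phi1_eq: "phi1 \<alpha> = form_of (phi1_list \<alpha>)"
  unfolding phi1_def by (rule kaehler_table[OF acts_as_unit_table])

lemma phi2_eq: "phi2 \<alpha> \<beta> = form_of (phi2_list \<alpha> \<beta>)"
  unfolding phi2_def
  by (rule kaehler_table[OF acts_as_comp_table[OF acts_as_unit_table acts_as_unit_table]]) simp

definition eta_list :: "(int \<times> nat list) list" where
  "eta_list = [(1, [0, 1, 2, 3]), (1, [0, 1, 4, 5]), (1, [0, 2, 4, 6]), (1, [0, 2, 5, 7]),
     (-1, [0, 1, 6, 7]), (-1, [0, 3, 5, 6]), (1, [0, 3, 4, 7])]"

definition hodge_list :: "(int \<times> nat list) list \<Rightarrow> (int \<times> nat list) list" where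
  "hodge_list l = map (\<lambda>(k, xs). let ys = filter (\<lambda>y. \<not> List.member xs y) [0..<8]
     in (k * isgn xs ys, ys)) l"

definition Phi_list :: "(int \<times> nat list) list" where
  "Phi_list = eta_list @ hodge_list eta_list"

text \<open>Prepending an index below all the others creates no inversion, so an increasing product
  carries the sign 1.\<close>

lemma dxs_cx:
  assumes "valid_monom xs" "sorted xs"
  shows "dxs (map cx xs) = axis (cx ` set xs) 1"
  using assms
proof (induction xs)
  case (Cons x xs)
  have "axis {cx x} 1 \<and>\<^sub>w axis (cx ` set xs) 1 = form_of (mwedge (1, [x]) (1, xs))"
    using Cons by (subst form_of_mwedge) (auto simp: valid_monom_def)
  also have "isgn [x] xs = 1"
  proof -
    have "(\<Prod>y\<leftarrow>xs. if y < x then - 1 else 1 :: int) = 1"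
      using Cons.prems(2) by (induction xs) auto
    then show ?thesis by (simp add: isgn_def)
  qed
  moreover have "x \<notin> set xs"
    using Cons.prems(1) by (simp add: valid_monom_def)
  ultimately have "axis {cx x} 1 \<and>\<^sub>w axis (cx ` set xs) 1 = axis (cx ` set (x # xs)) 1"
    by (simp add: mwedge_def form_of_Cons list_all_iff set_insort_key)
  with Cons show ?case
    by (simp add: dxs_def wedge_list_def dx_def valid_monom_def)
qed (simp add: dxs_def wedge_list_def)

lemma hodge_axis: "hodge (axis S 1) = wsign S (- S) *\<^sub>R axis (- S) 1"
  by (auto simp: hodge_def vec_eq_iff axis_def)

lemma linear_hodge: "linear hodge"
  by (rule linearI) (simp_all add: hodge_def vec_eq_iff algebra_simps)

lemma hodge_form_of: "valid_form l \<Longrightarrow> hodge (form_of l) = form_of (hodge_list l)"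
proof (induction l)
  case (Cons p l)
  obtain k xs where p: "p = (k, xs)" by force
  define ys where "ys = filter (\<lambda>y. y \<notin> set xs) [0..<8]"
  have xs: "valid_monom xs" and "valid_form l" using Cons.prems by (auto simp: valid_form_def p)
  have ys: "valid_monom ys" by (auto simp: ys_def valid_monom_def)
  have "- (cx ` set xs) = cx ` ({..<8} - set xs)"
    using inj_on_image_set_diff[OF inj_on_cx, of "{..<8}" "set xs"] xs
    by (auto simp: valid_monom_def UNIV_8 Compl_eq_Diff_UNIV)
  also have "{..<8} - set xs = set ys" by (auto simp: ys_def)
  finally have "hodge (axis (cx ` set xs) 1) = of_int (isgn xs ys) *\<^sub>R axis (cx ` set ys) 1"
    using wsign_cx[OF xs ys] by (simp add: hodge_axis)
  with Cons \<open>valid_form l\<close> show ?case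
    by (simp add: p form_of_Cons hodge_list_def linear_add[OF linear_hodge]
        linear_cmul[OF linear_hodge] ys_def Let_def)
qed (simp add: hodge_list_def linear_0[OF linear_hodge])

lemma valid_eta_list: "valid_form eta_list"
  by (simp add: eta_list_def valid_form_def valid_monom_def)

lemma valid_Phi_list: "valid_form Phi_list"
  using valid_eta_list by (auto simp: Phi_list_def hodge_list_def valid_form_def valid_monom_def Let_def)

lemma Phi_eq: "Phi_Spin7 = form_of Phi_list"
proof -
  have "eta_Spin7 = form_of eta_list"
  proof -
    have *: "dxs [cx a, cx b, cx c, cx d] = axis (cx ` set [a, b, c, d]) 1"
      if "a < b" "b < c" "c < d" "d < 8" for a b c d
      using dxs_cx[of "[a, b, c, d]"] that by (simp add: valid_monom_def)
    show ?thesis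
      unfolding eta_Spin7_def numeral_8_cx by (simp add: * eta_list_def form_of_Cons)
  qed
  then show ?thesis
    using hodge_form_of[OF valid_eta_list] by (simp add: Phi_Spin7_def Phi_list_def form_of_append)
qed

section \<open>Identities decided by evaluation, and their meaning for forms\<close>

definition units :: "im_unit list" where
  "units = [Ui, Uj, Uk, Ue, Uf, Ug, Uh]"

lemma units: "distinct units" "set units = UNIV"
  by (auto simp: units_def UNIV_im_unit)

lemma phi1_squares_list: "form_eq (fscale (- 6) Phi_list)
    (concat (map (\<lambda>\<alpha>. fwedge (phi1_list \<alpha>) (phi1_list \<alpha>)) units))"
  by code_simp

lemma phi2_squares_list: "form_eq (fscale 6 Phi_list)
    (concat (map (\<lambda>\<alpha>. concat (map (\<lambda>\<beta>. if unit_index \<alpha> < unit_index \<beta>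
        then fwedge (phi2_list \<alpha> \<beta>) (phi2_list \<alpha> \<beta>) else []) units)) units))"
  by code_simp

text \<open>This reflects that right multiplications by distinct imaginary units anticommute. It
  makes \<open>phi_matrix\<close> skew.\<close>

lemma phi2_anti_list: "list_all (\<lambda>\<alpha>. list_all (\<lambda>\<beta>. \<alpha> = \<beta> \<or> form_eq (phi2_list \<alpha> \<beta>)
    (fscale (- 1) (phi2_list \<beta> \<alpha>))) units) units"
  by code_simp

text \<open>The form has 14 monomials, seven pairs of complementary ones, and each contributes 1
  when multiplied by its complement. The identity will show that \<open>Spin7\<close> fixes the
  volume form.\<close>

lemma Phi_square_list: "form_eq (fwedge Phi_list Phi_list) [(14, [0..<8])]"
  by code_simp

text \<open>The coefficient of \<open>vol\<close> in \<open>\<Phi> \<and> dx\<^sub>p \<and> dx\<^sub>q\<close>, for pairs of coordinates \<open>p\<close>, \<open>q\<close>.\<close>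

definition pairing_entry :: "nat \<times> nat \<Rightarrow> nat \<times> nat \<Rightarrow> int" where
  "pairing_entry p q = (if p = q then 1 else 0)
     - (\<Sum>\<alpha>\<leftarrow>units. table_coeff (unit_table \<alpha>) (fst p) (snd p) * table_coeff (unit_table \<alpha>) (fst q) (snd q))"

text \<open>The polarised form, on basis 2-forms, of the quadratic identity for \<Phi> \<and> w
  \<and> w. It says that w goes to \<star>(\<Phi> \<and> w) with eigenvalue 1 on the 2-forms
  orthogonal to all \<open>phi1\<close> forms and -3 on their span.\<close>

lemma pairing_list: "list_all (\<lambda>p. list_all (\<lambda>q.
    form_eq (fwedge Phi_list (fwedge [(1, [fst p, snd p])] [(1, [fst q, snd q])]))
      [(pairing_entry p q, [0..<8])]) pairs8) pairs8"
  by code_simp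

text \<open>The Gram matrix of the \<open>phi1\<close> forms. Each has four monomials with
  coefficients 1 or -1, hence norm 2.\<close>

lemma phi1_gram_list: "list_all (\<lambda>\<alpha>. list_all (\<lambda>\<beta>.
    (\<Sum>(a, b)\<leftarrow>pairs8. table_coeff (unit_table \<alpha>) a b * table_coeff (unit_table \<beta>) a b)
      = (if \<alpha> = \<beta> then 4 else 0)) units) units"
  by code_simp

lemma sum_UNIV_units: "(\<Sum>\<alpha>\<in>UNIV. f \<alpha>) = (\<Sum>\<alpha>\<leftarrow>units. f \<alpha>)"
  using sum.distinct_set_conv_list[OF units(1), of f] by (simp add: units(2))

lemma sum_phi1_squares: "(\<Sum>\<alpha>\<in>UNIV. phi1 \<alpha> \<and>\<^sub>w phi1 \<alpha>) = (- 6) *\<^sub>R Phi_Spin7"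
proof -
  have "(\<Sum>\<alpha>\<in>UNIV. phi1 \<alpha> \<and>\<^sub>w phi1 \<alpha>) =
      form_of (concat (map (\<lambda>\<alpha>. fwedge (phi1_list \<alpha>) (phi1_list \<alpha>)) units))"
    unfolding form_of_concat map_map comp_def sum_UNIV_units phi1_eq
      form_of_fwedge[OF valid_table_form valid_table_form] ..
  also have "\<dots> = form_of (fscale (- 6) Phi_list)"
    by (rule form_of_eqI[OF phi1_squares_list, symmetric])
  finally show ?thesis
    unfolding form_of_fscale Phi_eq by simp
qed

lemma sum_phi2_squares:
  "(\<Sum>(\<alpha>, \<beta>)\<in>{(\<alpha>, \<beta>). unit_index \<alpha> < unit_index \<beta>}. phi2 \<alpha> \<beta> \<and>\<^sub>w phi2 \<alpha> \<beta>) = 6 *\<^sub>R Phi_Spin7"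
proof -
  have "(\<Sum>(\<alpha>, \<beta>)\<in>{(\<alpha>, \<beta>). unit_index \<alpha> < unit_index \<beta>}. phi2 \<alpha> \<beta> \<and>\<^sub>w phi2 \<alpha> \<beta>) =
      (\<Sum>(\<alpha>, \<beta>)\<in>UNIV \<times> UNIV. if unit_index \<alpha> < unit_index \<beta> then phi2 \<alpha> \<beta> \<and>\<^sub>w phi2 \<alpha> \<beta> else 0)"
    by (rule sum.mono_neutral_cong_left) (auto split: if_splits)
  also have "\<dots> = (\<Sum>\<alpha>\<leftarrow>units. \<Sum>\<beta>\<leftarrow>units.
      if unit_index \<alpha> < unit_index \<beta> then phi2 \<alpha> \<beta> \<and>\<^sub>w phi2 \<alpha> \<beta> else 0)"
    unfolding sum.cartesian_product[symmetric] sum_UNIV_units ..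
  also have "\<dots> = form_of (concat (map (\<lambda>\<alpha>. concat (map (\<lambda>\<beta>. if unit_index \<alpha> < unit_index \<beta>
        then fwedge (phi2_list \<alpha> \<beta>) (phi2_list \<alpha> \<beta>) else []) units)) units))"
    unfolding form_of_concat map_map comp_def if_distrib[of form_of] form_of_Nil phi2_eq
      form_of_fwedge[OF valid_table_form valid_table_form] ..
  also have "\<dots> = form_of (fscale 6 Phi_list)"
    by (rule form_of_eqI[OF phi2_squares_list, symmetric])
  finally show ?thesis
    unfolding form_of_fscale Phi_eq by simp
qed

lemma phi2_anticommute: "\<alpha> \<noteq> \<beta> \<Longrightarrow> phi2 \<alpha> \<beta> = - phi2 \<beta> \<alpha>"
  using phi2_anti_list form_of_eqI[of "phi2_list \<alpha> \<beta>" "fscale (- 1) (phi2_list \<beta> \<alpha>)"]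
  by (auto simp: list_all_iff units(2) form_of_fscale phi2_eq)

lemma cx_image_upt: "cx ` set [0..<8] = UNIV"
  by (simp only: UNIV_8 set_upt lessThan_atLeast0)

lemma Phi_square: "Phi_Spin7 \<and>\<^sub>w Phi_Spin7 = 14 *\<^sub>R axis UNIV 1"
proof -
  have "Phi_Spin7 \<and>\<^sub>w Phi_Spin7 = form_of (fwedge Phi_list Phi_list)"
    unfolding Phi_eq form_of_fwedge[OF valid_Phi_list valid_Phi_list] ..
  also have "\<dots> = form_of [(14, [0..<8])]"
    by (rule form_of_eqI[OF Phi_square_list])
  finally show ?thesis
    unfolding form_of_Cons form_of_Nil cx_image_upt by simp
qed

section \<open>The characteristic polynomial of a matrix with zero diagonal\<close>

text \<open>A permutation moving exactly two points must exchange them. The bound on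
  \<open>CARD('n)\<close> allows the truncated subtraction to be undone, so that the number of moved
  points is exactly 2.\<close>

lemma permutes_two_moved_iff:
  assumes "p permutes (UNIV :: 'n::finite set)"
  shows "card {i. p i = i} = CARD('n) - 2 \<and> 2 \<le> CARD('n) \<longleftrightarrow> (\<exists>a b. a \<noteq> b \<and> p = Transposition.transpose a b)"
    (is "?L \<longleftrightarrow> ?R")
proof -
  have compl: "card {i. p i = i} = CARD('n) - card {i. p i \<noteq> i}" "card {i. p i \<noteq> i} \<le> CARD('n)"
    using card_Diff_subset[of "{i. p i \<noteq> i}" UNIV]
    by (simp_all add: card_mono Compl_eq_Diff_UNIV[symmetric] Collect_neg_eq)
  show ?thesis
  proof
    assume ?L
    with compl have "card {i. p i \<noteq> i} = 2" by linarith
    then obtain a b where ab: "{i. p i \<noteq> i} = {a, b}" "a \<noteq> b" by (auto simp: card_2_iff)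
    have inj: "p x = p y \<longleftrightarrow> x = y" for x y
      using permutes_inj[OF assms] by (auto simp: inj_def)
    have moved: "p i \<noteq> i \<longleftrightarrow> i = a \<or> i = b" for i using ab(1) by auto
    \<comment> \<open>By injectivity the image of a moved point is again moved and differs from it,
      so it is the other one of the two.\<close>
    then have "p a = b" "p b = a" using inj by metis+
    with moved have "p = Transposition.transpose a b" by (auto simp: fun_eq_iff Transposition.transpose_def)
    with ab(2) show ?R by blast
  next
    assume ?R
    then obtain a b where ab: "a \<noteq> b" "p = Transposition.transpose a b" by blast
    then have "{i. p i \<noteq> i} = {a, b}" by (auto simp: Transposition.transpose_def)
    with ab have "card {i. p i \<noteq> i} = 2" by simp
    with compl show ?L by simp
  qed
qed

text \<open>With zero diagonal, a permutation contributes to the Leibniz expansion a monomial whose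
  degree is its number of fixed points. Degree n - 2 selects the transpositions, all of sign -1. The
  injection \<open>f\<close> orders the index type so that each transposition is counted
  once.\<close>

lemma coeff_charpoly_zero_diagonal:
  fixes M :: "'a::comm_ring_1^'n^'n" and f :: "'n \<Rightarrow> nat"
  assumes diag: "\<And>i. M $ i $ i = 0" and "inj f" and card: "2 \<le> CARD('n)"
  shows "coeff (charpoly M) (CARD('n) - 2) = - (\<Sum>(i, j)\<in>{(i, j). f i < f j}. M $ i $ j * M $ j $ i)"
proof -
  let ?n = "CARD('n)"
  let ?A = "mat [:0, 1:] - map_matrix (\<lambda>c. [:c:]) M"
  let ?fix = "\<lambda>p. {i :: 'n. p i = i}" and ?mov = "\<lambda>p. {i :: 'n. p i \<noteq> i}"
  have entry: "?A $ i $ j = (if i = j then monom 1 1 else [:- (M $ i $ j):])" for i j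
    by (simp add: mat_def map_matrix_def diag monom_altdef)
  have prod: "(\<Prod>i\<in>UNIV. ?A $ i $ p i) = monom (\<Prod>i\<in>?mov p. - (M $ i $ p i)) (card (?fix p))" for p
  proof -
    let ?a = "\<lambda>i. if i = p i then monom 1 1 else [:- (M $ i $ p i):]"
    have "(\<Prod>i\<in>UNIV. ?A $ i $ p i) = (\<Prod>i\<in>UNIV. ?a i)"
      by (simp only: entry)
    also have "\<dots> = (\<Prod>i\<in>?fix p. ?a i) * (\<Prod>i\<in>?mov p. ?a i)"
      by (subst prod.union_disjoint[symmetric]) (auto intro: prod.cong)
    also have "(\<Prod>i\<in>?fix p. ?a i) = monom 1 1 ^ card (?fix p)"
      by (subst prod_constant[symmetric]) (rule prod.cong, auto)
    also have "(\<Prod>i\<in>?mov p. ?a i) = (\<Prod>i\<in>?mov p. [:- (M $ i $ p i):])"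
      by (rule prod.cong) auto
    also have "\<dots> = [:\<Prod>i\<in>?mov p. - (M $ i $ p i):]"
    proof -
      have "(\<Prod>i\<in>S. [:g i:]) = [:\<Prod>i\<in>S. g i:]" for g :: "'n \<Rightarrow> 'a" and S
        by (induction S rule: infinite_finite_induct) (simp_all add: one_pCons)
      then show ?thesis .
    qed
    finally show ?thesis
      by (simp add: monom_power mult.commute[of "monom _ _"] smult_monom)
  qed
  let ?term = "\<lambda>p. of_int (sign p) * (\<Prod>i\<in>?mov p. - (M $ i $ p i))"
  have "coeff (charpoly M) (?n - 2) =
      (\<Sum>p | p permutes (UNIV :: 'n set). if card (?fix p) = ?n - 2 then ?term p else 0)"
    unfolding charpoly_def det_def coeff_sum prod
    by (intro sum.cong) (auto simp: of_int_poly)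
  also have "\<dots> = (\<Sum>p | p permutes (UNIV :: 'n set) \<and> card (?fix p) = ?n - 2. ?term p)"
    by (subst sum.inter_filter[symmetric]) (simp_all add: finite_permutations)
  also have "{p. p permutes (UNIV :: 'n set) \<and> card (?fix p) = ?n - 2}
      = (\<lambda>(i, j). Transposition.transpose i j) ` {(i, j). f i < f j}"
  proof (intro set_eqI iffI)
    fix p assume "p \<in> {p. p permutes (UNIV :: 'n set) \<and> card (?fix p) = ?n - 2}"
    then obtain a b where ab: "a \<noteq> b" "p = Transposition.transpose a b"
      using permutes_two_moved_iff[of p] card by auto
    then consider "f a < f b" | "f b < f a"
      using \<open>inj f\<close> by (metis injD linorder_neqE_nat)
    then show "p \<in> (\<lambda>(i, j). Transposition.transpose i j) ` {(i, j). f i < f j}"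
    proof cases
      case 1
      then show ?thesis using ab by (intro image_eqI[where x = "(a, b)"]) auto
    next
      case 2
      then show ?thesis using ab by (intro image_eqI[where x = "(b, a)"]) (auto simp: transpose_commute)
    qed
  next
    fix p assume "p \<in> (\<lambda>(i, j). Transposition.transpose i j) ` {(i, j). f i < f j}"
    then obtain a b where ab: "p = Transposition.transpose a b" "a \<noteq> b" by auto
    then have "p permutes UNIV" by (simp add: permutes_swap_id)
    with ab permutes_two_moved_iff[of p]
    show "p \<in> {p. p permutes (UNIV :: 'n set) \<and> card (?fix p) = ?n - 2}" by blast
  qed
  also have "(\<Sum>p\<in>(\<lambda>(i, j). Transposition.transpose i j) ` {(i, j). f i < f j}. ?term p)
      = (\<Sum>(i, j)\<in>{(i, j). f i < f j}. ?term (Transposition.transpose i j))"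
  proof (subst sum.reindex)
    show "inj_on (\<lambda>(i, j). Transposition.transpose i j) {(i, j). f i < f j}"
    proof (rule inj_onI, clarify)
      fix i j k l assume *: "f i < f j" "f k < f l" "Transposition.transpose i j = Transposition.transpose k l"
      then have "Transposition.transpose k l i = j" by (metis transpose_apply_first)
      with * have "i = k \<and> j = l \<or> i = l \<and> j = k" by (auto simp: Transposition.transpose_def split: if_splits)
      with * show "i = k \<and> j = l" by auto
    qed
  qed (simp add: case_prod_beta comp_def)
  also have "\<dots> = (\<Sum>(i, j)\<in>{(i, j). f i < f j}. - (M $ i $ j * M $ j $ i))"
  proof (rule sum.cong, simp, clarify)
    fix i j assume "f i < f j"
    then have "i \<noteq> j" by auto
    \<comment> \<open>The minus signs of the two moved factors cancel; the sign of the transposition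
      remains.\<close>
    then have "?mov (Transposition.transpose i j) = {i, j}" by (auto simp: Transposition.transpose_def)
    with \<open>i \<noteq> j\<close> show "?term (Transposition.transpose i j) = - (M $ i $ j * M $ j $ i)"
      by (simp add: sign_swap_id)
  qed
  finally show ?thesis by (simp add: sum_negf case_prod_beta)
qed

section \<open>The second coefficient for the matrix of Kaehler forms\<close>

lemma Rep_even_form_sum: "Rep_even_form (\<Sum>i\<in>I. f i) = (\<Sum>i\<in>I. Rep_even_form (f i))"
  by (induction I rule: infinite_finite_induct)
    (simp_all add: zero_even_form.rep_eq plus_even_form.rep_eq)

lemma inj_unit_index: "inj unit_index"
proof (rule injI)
  fix \<alpha> \<beta> show "unit_index \<alpha> = unit_index \<beta> \<Longrightarrow> \<alpha> = \<beta>"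
    by (cases \<alpha>; cases \<beta>) simp_all
qed

text \<open>There are 7 units, so the coefficient of degree 7 - 2 = 5 is the one just computed.
  Skewness turns each term - \<phi>_\<alpha>\<beta> \<phi>_\<beta>\<alpha> into a square.\<close>

lemma tau2_phi_matrix:
  assumes "\<And>\<alpha> \<beta>. \<alpha> \<noteq> \<beta> \<Longrightarrow> phi2 \<alpha> \<beta> = - phi2 \<beta> \<alpha>"
  shows "Rep_even_form (tau2 phi_matrix) =
    (\<Sum>(\<alpha>, \<beta>)\<in>{(\<alpha>, \<beta>). unit_index \<alpha> < unit_index \<beta>}. phi2 \<alpha> \<beta> \<and>\<^sub>w phi2 \<alpha> \<beta>)"
proof -
  have card: "CARD(im_unit) = 7" by (simp add: UNIV_im_unit)
  have "tau2 phi_matrix = - (\<Sum>(\<alpha>, \<beta>)\<in>{(\<alpha>, \<beta>). unit_index \<alpha> < unit_index \<beta>}.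
      phi_matrix $ \<alpha> $ \<beta> * phi_matrix $ \<beta> $ \<alpha>)"
    using coeff_charpoly_zero_diagonal[of phi_matrix, OF _ inj_unit_index]
    by (simp add: card tau2_def phi_matrix_def)
  also have "\<dots> = (\<Sum>(\<alpha>, \<beta>)\<in>{(\<alpha>, \<beta>). unit_index \<alpha> < unit_index \<beta>}.
      even_kaehler (R \<alpha> \<circ> R \<beta>) * even_kaehler (R \<alpha> \<circ> R \<beta>))"
    unfolding sum_negf[symmetric]
  proof (rule sum.cong, simp, clarify)
    fix \<alpha> \<beta> assume "unit_index \<alpha> < unit_index \<beta>"
    then have "\<alpha> \<noteq> \<beta>" by auto
    then have "even_kaehler (R \<beta> \<circ> R \<alpha>) = - even_kaehler (R \<alpha> \<circ> R \<beta>)"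
      using assms[of \<beta> \<alpha>] by (simp add: Rep_even_form_inject[symmetric] even_kaehler.rep_eq
          uminus_even_form.rep_eq phi2_def)
    with \<open>\<alpha> \<noteq> \<beta>\<close> show "- (phi_matrix $ \<alpha> $ \<beta> * phi_matrix $ \<beta> $ \<alpha>) =
        even_kaehler (R \<alpha> \<circ> R \<beta>) * even_kaehler (R \<alpha> \<circ> R \<beta>)"
      by (simp add: phi_matrix_def)
  qed
  finally show ?thesis
    by (simp add: Rep_even_form_sum case_prod_beta times_even_form.rep_eq even_kaehler.rep_eq phi2_def)
qed

section \<open>Pullback is an isometry and multiplicative\<close>

lemma wedge_sum_scaleR:
  "(\<Sum>i\<in>I. x i *\<^sub>R f i) \<and>\<^sub>w (\<Sum>j\<in>J. y j *\<^sub>R g j) = (\<Sum>i\<in>I. \<Sum>j\<in>J. (x i * y j) *\<^sub>R (f i \<and>\<^sub>w g j))"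
  unfolding wedge_sum_left
  by (simp add: wedge_sum_right wedge_scaleR_left wedge_scaleR_right scaleR_sum_right mult.commute)

text \<open>Applied to row i of a matrix \<open>A\<close>, this is the pullback of dx_i under
  \<open>A\<close>.\<close>

definition one_form :: "real^8 \<Rightarrow> form" where
  "one_form u = (\<Sum>j\<in>UNIV. (u $ j) *\<^sub>R dx j)"

lemma wsign_singleton_swap: "a \<noteq> b \<Longrightarrow> wsign {b} {a} = - wsign {a} {b}"
  using coord_less_linear[of a b] coord_less_asym[of a b] by (auto simp: wsign_singleton)

lemma wsign_singleton_mult [simp]: "a \<noteq> b \<Longrightarrow> wsign {a} {b} * wsign {b} {a} = - 1"
  by (simp add: wsign_singleton_swap[of a b])

lemma dx_anticommute: "dx a \<and>\<^sub>w dx b = - (dx b \<and>\<^sub>w dx a)"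
  by (auto simp: dx_wedge_dx wsign_singleton_swap[of a b] insert_commute)

lemma one_form_wedge:
  "one_form u \<and>\<^sub>w one_form v = (\<Sum>a\<in>UNIV. \<Sum>b\<in>UNIV. (u $ a * v $ b) *\<^sub>R (dx a \<and>\<^sub>w dx b))"
  by (simp add: one_form_def wedge_sum_scaleR)

lemma one_form_anticommute: "one_form u \<and>\<^sub>w one_form v = - (one_form v \<and>\<^sub>w one_form u)"
  unfolding one_form_wedge sum_negf[symmetric]
  by (subst sum.swap, intro sum.cong refl) (subst dx_anticommute, simp add: mult.commute)

lemma one_form_self: "one_form u \<and>\<^sub>w one_form u = 0"
  using one_form_anticommute[of u u] by (simp add: vec_eq_iff)

lemma one_form_self_wedge: "one_form u \<and>\<^sub>w one_form u \<and>\<^sub>w a = 0"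
  by (simp add: wedge_assoc[symmetric] one_form_self wedge_zero_left)

lemma one_form_swap: "one_form u \<and>\<^sub>w one_form v \<and>\<^sub>w a = - (one_form v \<and>\<^sub>w one_form u \<and>\<^sub>w a)"
  using one_form_anticommute[of u v] by (simp add: wedge_assoc[symmetric] wedge_minus_left)

text \<open>The pullback of a monomial, with the coordinate list as a parameter so that inductions
  over the list are possible.\<close>

definition list_form :: "real^8^8 \<Rightarrow> 8 list \<Rightarrow> 8 set \<Rightarrow> form" where
  "list_form A L S = wedge_list (map (\<lambda>i. one_form (A $ i)) (filter (\<lambda>i. i \<in> S) L))"

lemma list_form_Nil [simp]: "list_form A [] S = axis {} 1"
  and list_form_Cons: "list_form A (b # L) S =
    (if b \<in> S then one_form (A $ b) \<and>\<^sub>w list_form A L S else list_form A L S)"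
  by (simp_all add: list_form_def wedge_list_def)

lemma wsign_least: "(\<And>b. b \<in> S \<Longrightarrow> coord_less a b) \<Longrightarrow> wsign {a} S = 1"
proof -
  assume "\<And>b. b \<in> S \<Longrightarrow> coord_less a b"
  then have "{(s, t). s \<in> {a} \<and> t \<in> S \<and> coord_less t s} = {}"
    using coord_less_asym by blast
  then show ?thesis by (simp only: wsign_def card.empty power_0)
qed

text \<open>The new factor moves to its place past the factors with smaller index in
  \<open>S\<close>, changing sign each time, and \<open>wsign {a}\<close> counts exactly these. Only
  anticommutativity of 1-forms enters, so \<open>A\<close> is arbitrary.\<close>

lemma list_form_insert:
  assumes "sorted_wrt coord_less L" "a \<in> set L" "a \<notin> S"
  shows "one_form (A $ a) \<and>\<^sub>w list_form A L S = wsign {a} (S \<inter> set L) *\<^sub>R list_form A L (insert a S)"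
  using assms(1,2)
proof (induction L)
  case (Cons b L)
  then have sorted: "sorted_wrt coord_less L" and less: "\<And>c. c \<in> set L \<Longrightarrow> coord_less b c" by auto
  then have "b \<notin> set L" by fastforce
  show ?case
  proof (cases "a = b")
    case True
    have "list_form A L (insert a S) = list_form A L S"
    proof -
      have "filter (\<lambda>i. i \<in> insert a S) L = filter (\<lambda>i. i \<in> S) L"
        using \<open>b \<notin> set L\<close> True by (intro filter_cong) auto
      then show ?thesis by (simp only: list_form_def)
    qed
    moreover have "S \<inter> set (b # L) = S \<inter> set L" using True \<open>a \<notin> S\<close> by auto
    ultimately show ?thesis
      using True \<open>a \<notin> S\<close> less wsign_least[of "S \<inter> set L" b] by (simp add: list_form_Cons)
  next
    case False
    with Cons.prems have "a \<in> set L" by simp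
    note IH = Cons.IH[OF sorted this]
    show ?thesis
    proof (cases "b \<in> S")
      case True
      have "wsign {a} (S \<inter> set (b # L)) = - wsign {a} (S \<inter> set L)"
        using True wsign_insert_right[of b "S \<inter> set L" "{a}"] less[OF \<open>a \<in> set L\<close>] \<open>b \<notin> set L\<close>
        by (simp add: wsign_singleton)
      moreover have "one_form (A $ a) \<and>\<^sub>w list_form A (b # L) S
          = - (one_form (A $ b) \<and>\<^sub>w one_form (A $ a) \<and>\<^sub>w list_form A L S)"
        using True by (simp add: list_form_Cons one_form_swap[of "A $ a"])
      ultimately show ?thesis
        using True IH by (simp add: list_form_Cons wedge_scaleR_right)
    next
      case False
      then have "S \<inter> set (b # L) = S \<inter> set L" by auto
      with False \<open>a \<noteq> b\<close> IH show ?thesis by (simp add: list_form_Cons)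
    qed
  qed
qed simp

text \<open>The factor is moved next to its copy, and a 1-form squares to zero.\<close>

lemma list_form_absorb:
  assumes "a \<in> set L" "a \<in> S"
  shows "one_form (A $ a) \<and>\<^sub>w list_form A L S = 0"
  using assms(1)
proof (induction L)
  case (Cons b L)
  then show ?case
    using assms(2) one_form_swap[of "A $ a" "A $ b"]
    by (cases "a = b") (auto simp: list_form_Cons one_form_self_wedge wedge_zero_right)
qed simp

abbreviation set_form :: "real^8^8 \<Rightarrow> 8 set \<Rightarrow> form" where
  "set_form A S \<equiv> list_form A [1, 2, 3, 4, 5, 6, 7, 8] S"

lemma coord_list: "[1, 2, 3, 4, 5, 6, 7, 8] = map cx [0..<8]"
  by (simp add: numeral_8_cx upt_rec eval_nat_numeral)

lemma set_coord_list: "set [1, 2, 3, 4, 5, 6, 7, 8 :: 8] = UNIV"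
  unfolding coord_list by (auto simp: UNIV_8)

lemma sorted_coord_list: "sorted_wrt coord_less [1, 2, 3, 4, 5, 6, 7, 8]"
  unfolding coord_list sorted_wrt_map
  by (rule sorted_wrt_mono_rel[OF _ sorted_wrt_upt]) (simp add: coord_less_cx)

lemma set_form_insert:
  "a \<notin> S \<Longrightarrow> one_form (A $ a) \<and>\<^sub>w set_form A S = wsign {a} S *\<^sub>R set_form A (insert a S)"
  using list_form_insert[OF sorted_coord_list, of a S A] unfolding set_coord_list by simp

lemma set_form_insert':
  assumes "a \<notin> S"
  shows "set_form A (insert a S) = wsign {a} S *\<^sub>R (one_form (A $ a) \<and>\<^sub>w set_form A S)"
  using wsign_sq[of "{a}" S] by (simp add: set_form_insert[OF assms] del: wsign_sq)

lemma set_form_absorb: "a \<in> S \<Longrightarrow> one_form (A $ a) \<and>\<^sub>w set_form A S = 0"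
  by (rule list_form_absorb) (simp_all only: set_coord_list UNIV_I)

lemma set_form_empty [simp]: "set_form A {} = axis {} 1"
  by (simp add: list_form_def wedge_list_def)

text \<open>The pulled back monomials obey the multiplication rule \<open>wedge_axis\<close> of the
  monomials themselves. Hence \<open>pullback\<close> is multiplicative for every matrix.\<close>

lemma set_form_wedge:
  "set_form A S \<and>\<^sub>w set_form A T = (if S \<inter> T = {} then wsign S T *\<^sub>R set_form A (S \<union> T) else 0)"
  using finite_8[of S]
proof (induction S rule: finite_induct)
  case empty
  then show ?case by (simp add: wedge_one_left)
next
  case (insert a S)
  have *: "set_form A (insert a S) \<and>\<^sub>w set_form A T =
      wsign {a} S *\<^sub>R (one_form (A $ a) \<and>\<^sub>w (set_form A S \<and>\<^sub>w set_form A T))"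
    by (simp add: set_form_insert'[OF insert(2)] wedge_scaleR_left wedge_assoc)
  show ?case
  proof (cases "S \<inter> T = {} \<and> a \<notin> T")
    case True
    then have "one_form (A $ a) \<and>\<^sub>w set_form A (S \<union> T) = (wsign {a} S * wsign {a} T) *\<^sub>R set_form A (insert a (S \<union> T))"
      using insert(2) wsign_Un_right[of S T "{a}"] by (simp add: set_form_insert)
    \<comment> \<open>The factor \<open>wsign {a} S\<close> occurs twice, from splitting off a and
      from putting it back, and squares to 1.\<close>
    with True have "set_form A (insert a S) \<and>\<^sub>w set_form A T =
        ((wsign {a} S * wsign {a} S) * (wsign {a} T * wsign S T)) *\<^sub>R set_form A (insert a (S \<union> T))"
      unfolding * insert.IH by (simp add: wedge_scaleR_right mult_ac del: wsign_sq)
    with True show ?thesis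
      using wsign_insert_left[OF insert(2), of T] by simp
  next
    case False
    then show ?thesis
      unfolding * insert.IH
      by (auto simp: wedge_scaleR_right wedge_zero_right set_form_absorb)
  qed
qed

section \<open>Multiplicativity of the pullback\<close>

lemma pullback_eq: "pullback A a = (\<Sum>I\<in>UNIV. (a $ I) *\<^sub>R set_form A I)"
  by (simp add: pullback_def list_form_def one_form_def)

lemma linear_pullback: "linear (pullback A)"
  by (rule linearI)
    (simp_all add: pullback_eq scaleR_add_left sum.distrib scaleR_sum_right)

lemma pullback_axis: "pullback A (axis I 1) = set_form A I"
proof -
  have "pullback A (axis I 1) = (\<Sum>J\<in>UNIV. if J = I then set_form A J else 0)"
    unfolding pullback_eq by (intro sum.cong) (auto simp: axis_def)
  then show ?thesis by simp
qed

lemma form_expansion: "(a :: form) = (\<Sum>I\<in>UNIV. (a $ I) *\<^sub>R axis I 1)"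
  using basis_expansion[of a] by (simp add: scalar_mult_eq_scaleR)

lemma pullback_wedge: "pullback A (a \<and>\<^sub>w b) = pullback A a \<and>\<^sub>w pullback A b"
proof -
  have "a \<and>\<^sub>w b = (\<Sum>I\<in>UNIV. \<Sum>J\<in>UNIV. (a $ I * b $ J) *\<^sub>R (axis I 1 \<and>\<^sub>w axis J 1))"
    by (subst form_expansion[of a], subst form_expansion[of b]) (rule wedge_sum_scaleR)
  moreover have "pullback A (axis I 1 \<and>\<^sub>w axis J 1) = set_form A I \<and>\<^sub>w set_form A J" for I J
    by (simp add: wedge_axis set_form_wedge pullback_axis linear_cmul[OF linear_pullback]
        linear_0[OF linear_pullback])
  ultimately have "pullback A (a \<and>\<^sub>w b) =
      (\<Sum>I\<in>UNIV. \<Sum>J\<in>UNIV. (a $ I * b $ J) *\<^sub>R (set_form A I \<and>\<^sub>w set_form A J))"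
    by (simp only: linear_sum[OF linear_pullback] linear_cmul[OF linear_pullback])
  then show ?thesis by (simp only: pullback_eq wedge_sum_scaleR)
qed

lemma inner_dx_wedge_dx:
  "(dx a \<and>\<^sub>w dx b) \<bullet> (dx c \<and>\<^sub>w dx d) =
    (if a = c then 1 else 0) * (if b = d then 1 else 0) - (if a = d then 1 else 0) * (if b = c then 1 else 0)"
  by (cases "a = b"; cases "c = d")
    (auto simp: dx_wedge_dx inner_axis_axis doubleton_eq_iff)

text \<open>The Gram determinant of decomposable 2-forms, by bilinearity from the basis. It will
  show that orthogonal matrices preserve the norm of 2-forms.\<close>

lemma inner_one_form_wedge:
  "(one_form u \<and>\<^sub>w one_form v) \<bullet> (one_form x \<and>\<^sub>w one_form y) = (u \<bullet> x) * (v \<bullet> y) - (u \<bullet> y) * (v \<bullet> x)"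
proof -
  have 1: "(dx a \<and>\<^sub>w dx b) \<bullet> (one_form x \<and>\<^sub>w one_form y) = x $ a * y $ b - x $ b * y $ a" for a b
  proof -
    have "(dx a \<and>\<^sub>w dx b) \<bullet> (one_form x \<and>\<^sub>w one_form y) =
      (\<Sum>c\<in>UNIV. \<Sum>d\<in>UNIV. (if c = a then if d = b then x $ c * y $ d else 0 else 0)
         - (if c = b then if d = a then x $ c * y $ d else 0 else 0))"
      unfolding one_form_wedge inner_sum_right inner_scaleR_right inner_dx_wedge_dx
      by (intro sum.cong) auto
    also have "\<dots> = (\<Sum>c\<in>UNIV. (if c = a then x $ c * y $ b else 0) - (if c = b then x $ c * y $ a else 0))"
      by (intro sum.cong) (auto simp: sum_subtractf)
    also have "\<dots> = x $ a * y $ b - x $ b * y $ a" by (simp add: sum_subtractf)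
    finally show ?thesis .
  qed
  have "(one_form u \<and>\<^sub>w one_form v) \<bullet> (one_form x \<and>\<^sub>w one_form y) =
      (\<Sum>a\<in>UNIV. \<Sum>b\<in>UNIV. (u $ a * x $ a) * (v $ b * y $ b) - (u $ a * y $ a) * (v $ b * x $ b))"
    unfolding one_form_wedge[of u v] inner_sum_left inner_scaleR_left 1
    by (intro sum.cong) (auto simp: algebra_simps)
  then show ?thesis
    by (simp add: inner_vec_def sum_subtractf sum_product)
qed

lemma set_form_pair:
  assumes "a \<noteq> b"
  shows "set_form A {a, b} = wsign {a} {b} *\<^sub>R (one_form (A $ a) \<and>\<^sub>w one_form (A $ b))"
proof -
  \<comment> \<open>Since the unit form is even, it commutes with every form, so the left unit law
    also gives the right one.\<close>
  have "axis {} 1 \<in> even_forms" by (auto simp: even_forms_def axis_def)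
  then have "one_form u \<and>\<^sub>w axis {} 1 = one_form u" for u
    by (metis wedge_even_commute wedge_one_left)
  then have "set_form A {b} = one_form (A $ b)"
    using set_form_insert'[of b "{}" A] by simp
  then show ?thesis using set_form_insert'[of a "{b}" A] assms by simp
qed

section \<open>The invariant decomposition of the 2-forms\<close>

definition pair_form :: "nat \<times> nat \<Rightarrow> form" where
  "pair_form p = axis {cx (fst p), cx (snd p)} 1"

lemma bij_betw_pairs8: "bij_betw (\<lambda>(m, n). {cx m, cx n}) (set pairs8) {S. card S = 2}"
proof (rule bij_betwI')
  fix p q assume "p \<in> set pairs8" "q \<in> set pairs8"
  then show "((\<lambda>(m, n). {cx m, cx n}) p = (\<lambda>(m, n). {cx m, cx n}) q) = (p = q)"
    by (auto simp: set_pairs8 doubleton_eq_iff cx_eq_iff)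
next
  fix p assume "p \<in> set pairs8"
  then show "(\<lambda>(m, n). {cx m, cx n}) p \<in> {S. card S = 2}"
    by (auto simp: set_pairs8 cx_eq_iff)
next
  fix S :: "8 set" assume "S \<in> {S. card S = 2}"
  then obtain a b where S: "S = {a, b}" "a \<noteq> b" by (auto simp: card_2_iff)
  obtain m n where mn: "a = cx m" "b = cx n" "m < 8" "n < 8"
    using UNIV_8 by (metis UNIV_I imageE lessThan_iff)
  then consider "m < n" | "n < m" using S(2) by (metis linorder_neqE_nat)
  then show "\<exists>p\<in>set pairs8. S = (\<lambda>(m, n). {cx m, cx n}) p"
  proof cases
    case 1
    then show ?thesis using S mn by (intro bexI[where x = "(m, n)"]) (auto simp: set_pairs8)
  next
    case 2
    then show ?thesis using S mn by (intro bexI[where x = "(n, m)"]) (auto simp: set_pairs8)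
  qed
qed

lemma inner_pair_form:
  "p \<in> set pairs8 \<Longrightarrow> q \<in> set pairs8 \<Longrightarrow> pair_form p \<bullet> pair_form q = (if p = q then 1 else 0)"
  by (auto simp: pair_form_def inner_axis_axis set_pairs8 doubleton_eq_iff cx_eq_iff)

lemma subspace_Lambda2: "subspace Lambda2"
  by (auto simp: Lambda2_def subspace_def)

lemma pair_form_Lambda2: "p \<in> set pairs8 \<Longrightarrow> pair_form p \<in> Lambda2"
  by (auto simp: Lambda2_def pair_form_def axis_def set_pairs8 cx_eq_iff)

lemma Lambda2_expansion:
  assumes "w \<in> Lambda2"
  shows "w = (\<Sum>p\<in>set pairs8. (w \<bullet> pair_form p) *\<^sub>R pair_form p)"
proof -
  have "w = (\<Sum>I\<in>UNIV. (w $ I) *\<^sub>R axis I 1)" by (rule form_expansion)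
  also have "\<dots> = (\<Sum>I\<in>{S. card S = 2}. (w $ I) *\<^sub>R axis I 1)"
    using assms by (intro sum.mono_neutral_right) (auto simp: Lambda2_def)
  also have "\<dots> = (\<Sum>p\<in>set pairs8. (w \<bullet> pair_form p) *\<^sub>R pair_form p)"
    by (subst sum.reindex_bij_betw[OF bij_betw_pairs8, symmetric])
      (simp add: case_prod_beta pair_form_def inner_axis)
  finally show ?thesis .
qed

lemma inner_Lambda2:
  assumes "w \<in> Lambda2"
  shows "w \<bullet> v = (\<Sum>p\<in>set pairs8. (w \<bullet> pair_form p) * (v \<bullet> pair_form p))"
  by (subst Lambda2_expansion[OF assms]) (simp add: inner_sum_left inner_commute[of v])

lemma phi1_expansion:
  "phi1 \<alpha> = (\<Sum>p\<in>set pairs8. of_int (table_coeff (unit_table \<alpha>) (fst p) (snd p)) *\<^sub>R pair_form p)"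
  unfolding sum.distinct_set_conv_list[OF distinct_pairs8]
  unfolding phi1_eq table_form_def form_of_filter unfolding case_prod_beta form_of_map pair_form_def
  by simp

lemma phi1_Lambda2: "phi1 \<alpha> \<in> Lambda2"
  unfolding phi1_expansion
  by (intro subspace_sum[OF subspace_Lambda2] subspace_scale[OF subspace_Lambda2] pair_form_Lambda2)

lemma inner_phi1_pair_form:
  assumes "p \<in> set pairs8"
  shows "phi1 \<alpha> \<bullet> pair_form p = of_int (table_coeff (unit_table \<alpha>) (fst p) (snd p))"
proof -
  have "phi1 \<alpha> \<bullet> pair_form p =
      (\<Sum>q\<in>set pairs8. if q = p then of_int (table_coeff (unit_table \<alpha>) (fst q) (snd q)) else 0)"
    unfolding phi1_expansion inner_sum_left
    by (intro sum.cong) (auto simp: inner_pair_form assms)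
  then show ?thesis using assms by simp
qed

lemma inner_phi1_phi1: "phi1 \<alpha> \<bullet> phi1 \<beta> = (if \<alpha> = \<beta> then 4 else 0)"
proof -
  have "phi1 \<alpha> \<bullet> phi1 \<beta> = (\<Sum>p\<in>set pairs8. of_int (table_coeff (unit_table \<alpha>) (fst p) (snd p)
      * table_coeff (unit_table \<beta>) (fst p) (snd p)))"
    unfolding inner_Lambda2[OF phi1_Lambda2, of \<alpha> "phi1 \<beta>"]
    by (intro sum.cong) (simp_all add: inner_phi1_pair_form)
  also have "\<dots> = of_int (\<Sum>p\<in>set pairs8. table_coeff (unit_table \<alpha>) (fst p) (snd p)
      * table_coeff (unit_table \<beta>) (fst p) (snd p))"
    by simp
  also have "(\<Sum>p\<in>set pairs8. table_coeff (unit_table \<alpha>) (fst p) (snd p)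
      * table_coeff (unit_table \<beta>) (fst p) (snd p)) = (if \<alpha> = \<beta> then 4 else 0)"
    using phi1_gram_list
    unfolding sum.distinct_set_conv_list[OF distinct_pairs8] list_all_iff units(2) case_prod_beta by blast
  also have "of_int (if \<alpha> = \<beta> then 4 else 0) = (if \<alpha> = \<beta> then 4 else 0)"
    by simp
  finally show ?thesis .
qed

lemma sum_pair_form_squares: "(\<Sum>p\<in>set pairs8. pair_form p \<and>\<^sub>w pair_form p) = 0"
  by (simp add: pair_form_def wedge_axis)

lemma Phi_wedge_pair_forms:
  assumes "p \<in> set pairs8" "q \<in> set pairs8"
  shows "Phi_Spin7 \<and>\<^sub>w pair_form p \<and>\<^sub>w pair_form q =
    ((if p = q then 1 else 0) - (\<Sum>\<alpha>\<in>UNIV. (phi1 \<alpha> \<bullet> pair_form p) * (phi1 \<alpha> \<bullet> pair_form q))) *\<^sub>R axis UNIV 1"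
proof -
  have valid: "valid_form [(1, [fst r, snd r])]" if "r \<in> set pairs8" for r
    using that by (auto simp: valid_form_def set_pairs8 valid_monom_pair)
  have "form_eq (fwedge Phi_list (fwedge [(1, [fst p, snd p])] [(1, [fst q, snd q])]))
      [(pairing_entry p q, [0..<8])]"
    using pairing_list assms by (simp add: list_all_iff)
  from form_of_eqI[OF this]
  have "form_of Phi_list \<and>\<^sub>w form_of [(1, [fst p, snd p])] \<and>\<^sub>w form_of [(1, [fst q, snd q])] =
      form_of [(pairing_entry p q, [0..<8])]"
    by (simp only: form_of_fwedge valid_form_fwedge valid assms valid_Phi_list)
  moreover have "form_of [(1, [fst r, snd r])] = pair_form r" for r
    by (simp add: form_of_Cons pair_form_def)
  ultimately have "Phi_Spin7 \<and>\<^sub>w pair_form p \<and>\<^sub>w pair_form q = of_int (pairing_entry p q) *\<^sub>R axis UNIV 1"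
    by (simp only: Phi_eq form_of_Cons[where l = "[]"] form_of_Nil cx_image_upt add_0_right)
  also have "of_int (pairing_entry p q) =
      (if p = q then 1 else 0) - (\<Sum>\<alpha>\<in>UNIV. (phi1 \<alpha> \<bullet> pair_form p) * (phi1 \<alpha> \<bullet> pair_form q))"
    unfolding pairing_entry_def sum_UNIV_units[symmetric]
    by (simp add: inner_phi1_pair_form assms)
  finally show ?thesis .
qed

text \<open>The identity for pairs of monomials, summed against the coordinates of \<open>w\<close>.
  The diagonal part gives the squared norm, and the rest factors into squares once the sum over the
  units is moved outside.\<close>

lemma Phi_wedge_square:
  assumes "w \<in> Lambda2"
  shows "Phi_Spin7 \<and>\<^sub>w w \<and>\<^sub>w w = (w \<bullet> w - (\<Sum>\<alpha>\<in>UNIV. (w \<bullet> phi1 \<alpha>)\<^sup>2)) *\<^sub>R axis UNIV 1"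
proof -
  let ?c = "\<lambda>p. w \<bullet> pair_form p" and ?P = "set pairs8"
  let ?e = "\<lambda>p q. (if p = q then 1 else 0)
    - (\<Sum>\<alpha>\<in>UNIV. (phi1 \<alpha> \<bullet> pair_form p) * (phi1 \<alpha> \<bullet> pair_form q))"
  have inner: "w \<bullet> phi1 \<alpha> = (\<Sum>p\<in>?P. ?c p * (phi1 \<alpha> \<bullet> pair_form p))" for \<alpha>
    by (rule inner_Lambda2[OF assms])
  have "w \<and>\<^sub>w w = (\<Sum>p\<in>?P. \<Sum>q\<in>?P. (?c p * ?c q) *\<^sub>R (pair_form p \<and>\<^sub>w pair_form q))"
    unfolding wedge_sum_scaleR[symmetric]
    by (rule arg_cong2[where f = "(\<and>\<^sub>w)"]) (rule Lambda2_expansion[OF assms])+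
  then have "Phi_Spin7 \<and>\<^sub>w w \<and>\<^sub>w w =
      (\<Sum>p\<in>?P. \<Sum>q\<in>?P. (?c p * ?c q) *\<^sub>R (Phi_Spin7 \<and>\<^sub>w pair_form p \<and>\<^sub>w pair_form q))"
    by (simp only: wedge_sum_right wedge_scaleR_right)
  also have "\<dots> = (\<Sum>p\<in>?P. \<Sum>q\<in>?P. (?c p * ?c q * ?e p q) *\<^sub>R axis UNIV 1)"
    by (intro sum.cong) (simp_all add: Phi_wedge_pair_forms)
  also have "\<dots> = (\<Sum>p\<in>?P. \<Sum>q\<in>?P. ?c p * ?c q * ?e p q) *\<^sub>R axis UNIV 1"
    by (simp only: scaleR_sum_left)
  also have "(\<Sum>p\<in>?P. \<Sum>q\<in>?P. ?c p * ?c q * ?e p q) =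
      (\<Sum>p\<in>?P. \<Sum>q\<in>?P. if q = p then ?c p * ?c q else 0)
      - (\<Sum>p\<in>?P. \<Sum>q\<in>?P. \<Sum>\<alpha>\<in>UNIV. (?c p * (phi1 \<alpha> \<bullet> pair_form p)) * (?c q * (phi1 \<alpha> \<bullet> pair_form q)))"
    unfolding sum_subtractf[symmetric]
    by (intro sum.cong) (auto simp: algebra_simps sum_distrib_left)
  also have "(\<Sum>p\<in>?P. \<Sum>q\<in>?P. if q = p then ?c p * ?c q else 0) = w \<bullet> w"
    by (simp add: inner_Lambda2[OF assms, of w])
  also have "(\<Sum>p\<in>?P. \<Sum>q\<in>?P. \<Sum>\<alpha>\<in>UNIV. (?c p * (phi1 \<alpha> \<bullet> pair_form p)) * (?c q * (phi1 \<alpha> \<bullet> pair_form q)))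
      = (\<Sum>\<alpha>\<in>UNIV. \<Sum>p\<in>?P. \<Sum>q\<in>?P. (?c p * (phi1 \<alpha> \<bullet> pair_form p)) * (?c q * (phi1 \<alpha> \<bullet> pair_form q)))"
    by (subst sum.swap[of _ UNIV], subst sum.swap[of _ UNIV]) (rule refl)
  also have "\<dots> = (\<Sum>\<alpha>\<in>UNIV. (w \<bullet> phi1 \<alpha>)\<^sup>2)"
    by (simp add: inner power2_eq_square sum_product)
  finally show ?thesis .
qed

lemma pullback_Lambda2:
  assumes "w \<in> Lambda2"
  shows "pullback A w \<in> Lambda2"
proof -
  have "set_form A S \<in> Lambda2" if S: "card S = 2" for S
  proof -
    obtain a b where "S = {a, b}" "a \<noteq> b" using S by (auto simp: card_2_iff)
    moreover have "dx a \<and>\<^sub>w dx b \<in> Lambda2" for a b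
      by (auto simp: dx_wedge_dx Lambda2_def axis_def)
    ultimately show ?thesis
      unfolding one_form_wedge set_form_pair[OF \<open>a \<noteq> b\<close>] \<open>S = {a, b}\<close>
      by (intro subspace_sum[OF subspace_Lambda2] subspace_scale[OF subspace_Lambda2])
  qed
  then have "(w $ S) *\<^sub>R set_form A S \<in> Lambda2" for S
    using assms subspace_scale[OF subspace_Lambda2] subspace_0[OF subspace_Lambda2]
    by (cases "card S = 2") (auto simp: Lambda2_def)
  then show ?thesis
    unfolding pullback_eq by (intro subspace_sum[OF subspace_Lambda2])
qed

lemma inner_rows_orthogonal_matrix:
  fixes A :: "real^'n^'n"
  assumes "orthogonal_matrix A"
  shows "A $ i \<bullet> A $ j = (if i = j then 1 else 0)"
proof -
  have "(A ** transpose A) $ i $ j = (mat 1 :: real^'n^'n) $ i $ j"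
    using assms by (simp add: orthogonal_matrix_def)
  then show ?thesis
    by (simp add: matrix_matrix_mult_def transpose_def mat_def inner_vec_def)
qed

text \<open>The rows of \<open>A\<close> are orthonormal, so by the Gram determinant the pulled back
  basis 2-forms are orthonormal too.\<close>

lemma inner_pullback_Lambda2:
  assumes "orthogonal_matrix A" and w: "w \<in> Lambda2"
  shows "pullback A w \<bullet> pullback A w = w \<bullet> w"
proof -
  let ?c = "\<lambda>p. w \<bullet> pair_form p" and ?P = "set pairs8"
  have inner: "pullback A (pair_form p) \<bullet> pullback A (pair_form q) = (if q = p then 1 else 0)"
    if "p \<in> ?P" "q \<in> ?P" for p q
  proof -
    have lt: "fst p < snd p" "snd p < 8" "fst q < snd q" "snd q < 8"
      using that by (auto simp: set_pairs8)
    have "pullback A (pair_form r) = one_form (A $ cx (fst r)) \<and>\<^sub>w one_form (A $ cx (snd r))"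
      if "fst r < snd r" "snd r < 8" for r
      using that coord_less_cx[of "snd r" "fst r"]
      by (simp add: pair_form_def pullback_axis set_form_pair cx_eq_iff wsign_singleton)
    with lt show ?thesis
      by (auto simp: inner_one_form_wedge inner_rows_orthogonal_matrix[OF assms(1)] cx_eq_iff prod_eq_iff)
  qed
  have pb: "pullback A w = (\<Sum>p\<in>?P. ?c p *\<^sub>R pullback A (pair_form p))"
    by (subst Lambda2_expansion[OF w])
      (simp only: linear_sum[OF linear_pullback] linear_cmul[OF linear_pullback])
  have "pullback A w \<bullet> pullback A w = (\<Sum>p\<in>?P. \<Sum>q\<in>?P. if q = p then ?c p * ?c q else 0)"
    unfolding pb inner_sum_left inner_sum_right
    by (intro sum.cong) (auto simp: inner)
  then show ?thesis by (simp add: inner_Lambda2[OF w, of w])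
qed

section \<open>Invariance of the orthogonal complement and uniqueness of the decomposition\<close>

definition Lambda2_21 :: "form set" where
  "Lambda2_21 = {w \<in> Lambda2. \<forall>\<alpha>. w \<bullet> phi1 \<alpha> = 0}"

text \<open>The 2-forms in question are those with \<Phi> \<and> w \<and> w = |w|^2 vol, since by
  \<open>Phi_wedge_square\<close> the defect is a sum of squares. \<open>Spin7\<close> preserves
  both sides of this equation.\<close>

lemma Lambda2_21_invariant: "Spin7_invariant Lambda2_21"
proof -
  have "subspace Lambda2_21"
    using subspace_Lambda2 by (auto simp: Lambda2_21_def subspace_def inner_left_distrib)
  moreover have "pullback A w \<in> Lambda2_21" if A: "A \<in> Spin7" and w: "w \<in> Lambda2_21" for A w
  proof -
    have Phi: "pullback A Phi_Spin7 = Phi_Spin7" and orth: "orthogonal_matrix A"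
      using A by (auto simp: Spin7_def rotation_matrix_def)
    have w2: "w \<in> Lambda2" and phi: "w \<bullet> phi1 \<alpha> = 0" for \<alpha>
      using w by (auto simp: Lambda2_21_def)
    \<comment> \<open>Invariance of the volume form is read off from \<open>Phi_square\<close>, as
      pullback is multiplicative.\<close>
    have "14 *\<^sub>R pullback A (axis UNIV 1) = 14 *\<^sub>R axis UNIV (1 :: real)"
      using pullback_wedge[of A Phi_Spin7 Phi_Spin7]
      by (simp add: Phi Phi_square linear_cmul[OF linear_pullback])
    then have vol: "pullback A (axis UNIV 1) = axis UNIV 1" by simp
    have "Phi_Spin7 \<and>\<^sub>w pullback A w \<and>\<^sub>w pullback A w = pullback A (Phi_Spin7 \<and>\<^sub>w w \<and>\<^sub>w w)"
      by (simp add: pullback_wedge Phi)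
    also have "\<dots> = (w \<bullet> w) *\<^sub>R axis UNIV 1"
      by (simp add: Phi_wedge_square[OF w2] phi linear_cmul[OF linear_pullback] vol)
    finally have "(w \<bullet> w - (\<Sum>\<alpha>\<in>UNIV. (pullback A w \<bullet> phi1 \<alpha>)\<^sup>2)) *\<^sub>R axis UNIV (1 :: real)
        = (w \<bullet> w) *\<^sub>R (axis UNIV 1 :: form)"
      by (simp add: Phi_wedge_square[OF pullback_Lambda2[OF w2]] inner_pullback_Lambda2[OF orth w2])
    moreover have "axis UNIV 1 \<noteq> (0 :: form)" by (simp add: axis_eq_0_iff)
    ultimately have "(\<Sum>\<alpha>\<in>UNIV. (pullback A w \<bullet> phi1 \<alpha>)\<^sup>2) = 0" by simp
    then have "pullback A w \<bullet> phi1 \<alpha> = 0" for \<alpha>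
      by (simp add: sum_nonneg_eq_0_iff)
    then show ?thesis
      using pullback_Lambda2[OF w2] by (simp add: Lambda2_21_def)
  qed
  ultimately show ?thesis by (simp add: Spin7_invariant_def)
qed

definition half_phi1 :: "form set" where
  "half_phi1 = range (\<lambda>\<alpha>. (1/2) *\<^sub>R phi1 \<alpha>)"

lemma half_phi1_orthonormal:
  "pairwise orthogonal half_phi1" "b \<in> half_phi1 \<Longrightarrow> norm b = 1" "inj (\<lambda>\<alpha>. (1/2) *\<^sub>R phi1 \<alpha>)"
proof -
  show "pairwise orthogonal half_phi1"
    by (auto simp: pairwise_def half_phi1_def orthogonal_def inner_phi1_phi1)
  show "b \<in> half_phi1 \<Longrightarrow> norm b = 1"
    by (auto simp: half_phi1_def norm_eq_sqrt_inner inner_phi1_phi1)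
  have "\<alpha> = \<beta>" if "phi1 \<alpha> = phi1 \<beta>" for \<alpha> \<beta>
    using inner_phi1_phi1[of \<alpha> \<alpha>] inner_phi1_phi1[of \<alpha> \<beta>] that by (auto split: if_splits)
  then show "inj (\<lambda>\<alpha>. (1/2) *\<^sub>R phi1 \<alpha>)" by (auto simp: inj_def)
qed

lemma orthonormal_independent:
  assumes "pairwise orthogonal B" "\<forall>b\<in>B. norm b = 1"
  shows "independent B"
  using assms by (intro pairwise_orthogonal_independent) auto

lemma dim_span_half_phi1: "dim (span half_phi1) = 7"
proof -
  have "independent half_phi1"
    using half_phi1_orthonormal by (intro orthonormal_independent) auto
  then have "dim (span half_phi1) = card half_phi1"
    by (simp add: dim_span dim_eq_card_independent)
  also have "\<dots> = CARD(im_unit)"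
    unfolding half_phi1_def by (rule card_image[OF half_phi1_orthonormal(3)])
  finally show ?thesis by (simp add: UNIV_im_unit)
qed

text \<open>The space \<open>V21\<close> is too large to meet \<open>Lambda2_21\<close> only in 0.
  The intersection is invariant, so by irreducibility \<open>V21\<close> is orthogonal to all
  \<open>phi1\<close> forms. These then lie in \<open>V7\<close>, which they span by
  dimension.\<close>

lemma Spin7_decomposition_unique:
  assumes "Spin7_decomposition V7 V21"
  shows "V7 = span half_phi1"
proof -
  have irr: "Spin7_irreducible V21" and dims: "dim V7 = 7" "dim V21 = 21"
    and orth: "\<And>v w. v \<in> V7 \<Longrightarrow> w \<in> V21 \<Longrightarrow> v \<bullet> w = 0"
    and sum: "{v + w |v w. v \<in> V7 \<and> w \<in> V21} = Lambda2"
    and sub: "subspace V7" "subspace V21"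
    using assms by (auto simp: Spin7_decomposition_def Spin7_irreducible_def Spin7_invariant_def orthogonal_def)
  have "v \<in> Lambda2" if "v \<in> V21" for v
  proof -
    have "0 + v \<in> {v + w |v w. v \<in> V7 \<and> w \<in> V21}" using that subspace_0[OF sub(1)] by blast
    then show ?thesis by (simp add: sum)
  qed
  then have V21: "V21 \<subseteq> Lambda2" by blast
  define f :: "form \<Rightarrow> real^im_unit" where "f w = (\<chi> \<alpha>. w \<bullet> phi1 \<alpha>)" for w
  have "linear f"
    by (rule linearI) (simp_all add: f_def vec_eq_iff inner_left_distrib)
  \<comment> \<open>A linear map from dimension 21 to dimension 7 has a nonzero kernel element, here
    a form orthogonal to every \<open>phi1\<close>.\<close>
  have "\<not> inj_on f V21"
  proof
    assume "inj_on f V21"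
    then have "dim (f ` V21) = dim V21"
      using sub(2) \<open>linear f\<close> by (intro dim_image_eq) (simp_all add: span_eq_iff[THEN iffD2])
    moreover have "dim (f ` V21) \<le> DIM(real^im_unit)" by (rule dim_subset_UNIV)
    ultimately show False using dims by (simp add: UNIV_im_unit)
  qed
  then obtain w where w: "w \<in> V21" "f w = 0" "w \<noteq> 0"
    using linear_injective_on_subspace_0[OF \<open>linear f\<close> sub(2)] by blast
  then have "w \<in> V21 \<inter> Lambda2_21"
    using V21 by (auto simp: Lambda2_21_def f_def vec_eq_iff)
  moreover have "Spin7_invariant (V21 \<inter> Lambda2_21)"
    using irr Lambda2_21_invariant
    by (auto simp: Spin7_irreducible_def Spin7_invariant_def subspace_inter)
  ultimately have "V21 \<inter> Lambda2_21 = V21"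
    using irr w(3) by (auto simp: Spin7_irreducible_def)
  then have phi_orth: "w \<bullet> phi1 \<alpha> = 0" if "w \<in> V21" for w \<alpha>
    using that by (auto simp: Lambda2_21_def)
  have "phi1 \<alpha> \<in> V7" for \<alpha>
  proof -
    obtain v w where vw: "phi1 \<alpha> = v + w" "v \<in> V7" "w \<in> V21"
      using phi1_Lambda2[of \<alpha>] by (auto simp flip: sum)
    \<comment> \<open>The component \<open>w\<close> is orthogonal both to the sum
      \<open>phi1 \<alpha>\<close> and to \<open>v\<close>, hence to itself.\<close>
    then have "w \<bullet> w = 0"
      using phi_orth[of w \<alpha>] orth[of v w] by (simp add: inner_add_right inner_commute)
    with vw show ?thesis by simp
  qed
  then have "half_phi1 \<subseteq> V7"
    using subspace_scale[OF sub(1)] by (auto simp: half_phi1_def)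
  then have "span half_phi1 \<subseteq> V7" using sub(1) by (rule span_minimal)
  with sub(1) show ?thesis
    by (intro subspace_dim_equal[symmetric]) (simp_all add: dims dim_span_half_phi1 del: dim_span)
qed

text \<open>The trace of a bilinear map on a Euclidean space does not depend on the orthonormal
  basis. One argument is expanded in \<open>C\<close>; after exchanging the sums, the other is
  reassembled from its expansion in \<open>B\<close>.\<close>

lemma orthonormal_sum_bilinear:
  fixes h :: "'a::euclidean_space \<Rightarrow> 'a \<Rightarrow> 'b::real_vector"
  assumes "bilinear h" and span: "span B = span C"
    and B: "pairwise orthogonal B" "\<forall>b\<in>B. norm b = 1" and C: "pairwise orthogonal C" "\<forall>c\<in>C. norm c = 1"
  shows "(\<Sum>b\<in>B. h b b) = (\<Sum>c\<in>C. h c c)"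
proof -
  have fin: "finite B" "finite C"
    using B C orthonormal_independent independent_imp_finite by blast+
  have lin: "linear (\<lambda>x. h x y)" "linear (h x)" for x y
    using \<open>bilinear h\<close> by (auto simp: bilinear_def)
  have "h b b = (\<Sum>c\<in>C. (b \<bullet> c) *\<^sub>R h c b)" if "b \<in> B" for b
  proof -
    have "b = (\<Sum>c\<in>C. (b \<bullet> c) *\<^sub>R c)"
      using that span_base[of b B] C fin by (subst orthonormal_basis_expand) (auto simp: span)
    then have "h b b = h (\<Sum>c\<in>C. (b \<bullet> c) *\<^sub>R c) b" by simp
    then show ?thesis by (simp only: linear_sum[OF lin(1)] linear_cmul[OF lin(1)])
  qed
  then have "(\<Sum>b\<in>B. h b b) = (\<Sum>b\<in>B. \<Sum>c\<in>C. (b \<bullet> c) *\<^sub>R h c b)" by simp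
  also have "\<dots> = (\<Sum>c\<in>C. h c (\<Sum>b\<in>B. (c \<bullet> b) *\<^sub>R b))"
    by (subst sum.swap) (simp add: linear_sum[OF lin(2)] linear_cmul[OF lin(2)] inner_commute)
  also have "\<dots> = (\<Sum>c\<in>C. h c c)"
  proof (rule sum.cong)
    fix c assume "c \<in> C"
    then have "(\<Sum>b\<in>B. (c \<bullet> b) *\<^sub>R b) = c"
      using span_base[of c C] B fin by (intro orthonormal_basis_expand) (auto simp: span)
    then show "h c (\<Sum>b\<in>B. (c \<bullet> b) *\<^sub>R b) = h c c" by simp
  qed simp
  finally show ?thesis .
qed

lemma sum_half_phi1_squares: "(\<Sum>b\<in>half_phi1. b \<and>\<^sub>w b) = - (3/2) *\<^sub>R Phi_Spin7"
proof -
  have "(\<Sum>b\<in>half_phi1. b \<and>\<^sub>w b) = (\<Sum>\<alpha>\<in>UNIV. (1/4) *\<^sub>R (phi1 \<alpha> \<and>\<^sub>w phi1 \<alpha>))"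
    unfolding half_phi1_def
    by (subst sum.reindex[OF half_phi1_orthonormal(3)]) (simp add: wedge_scaleR_left wedge_scaleR_right)
  also have "\<dots> = (1/4) *\<^sub>R (- 6) *\<^sub>R Phi_Spin7"
    by (simp only: scaleR_sum_right[symmetric] sum_phi1_squares)
  finally show ?thesis by simp
qed

lemma orthonormal_basis_Lambda2: "orthonormal_basis Lambda2 (pair_form ` set pairs8)"
proof -
  have "Lambda2 \<subseteq> span (pair_form ` set pairs8)"
  proof
    fix w assume "w \<in> Lambda2"
    then show "w \<in> span (pair_form ` set pairs8)"
      by (subst Lambda2_expansion) (auto intro!: span_sum span_scale intro: span_base)
  qed
  moreover have "span (pair_form ` set pairs8) \<subseteq> Lambda2"
    using pair_form_Lambda2 by (intro span_minimal subspace_Lambda2) auto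
  moreover have "norm (pair_form p) = 1" if "p \<in> set pairs8" for p
    using inner_pair_form[OF that that] by (simp add: norm_eq_sqrt_inner)
  ultimately show ?thesis
    using pair_form_Lambda2 inner_pair_form
    by (auto simp: orthonormal_basis_def pairwise_def orthogonal_def)
qed

lemma orthonormal_basis_squares:
  assumes "orthonormal_basis V B" "orthonormal_basis V C"
  shows "(\<Sum>b\<in>B. b \<and>\<^sub>w b) = (\<Sum>c\<in>C. c \<and>\<^sub>w c)"
  using assms by (intro orthonormal_sum_bilinear[OF bilinear_wedge]) (auto simp: orthonormal_basis_def)

lemma orthonormal_basis_half_phi1: "orthonormal_basis (span half_phi1) half_phi1"
  using half_phi1_orthonormal by (auto simp: orthonormal_basis_def span_base)

text \<open>Every orthonormal basis of \<open>V7\<close> gives the same sum as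
  \<open>half_phi1\<close>, and the constant is the reciprocal of -3/2, which is -6 divided by the
  squared norm 4.\<close>

lemma orthonormal_basis_squares_7:
  assumes "Spin7_decomposition V7 V21" "orthonormal_basis V7 B"
  shows "Phi_Spin7 = - (2/3) *\<^sub>R (\<Sum>b\<in>B. b \<and>\<^sub>w b)"
  using orthonormal_basis_squares[OF _ orthonormal_basis_half_phi1] assms
  by (simp add: Spin7_decomposition_unique[OF assms(1)] sum_half_phi1_squares)

text \<open>Together, \<open>half_phi1\<close> and \<open>B\<close> form an orthonormal basis of all
  2-forms, whose sum of squares is that of the monomials. Each monomial squares to zero, so the sum
  over \<open>B\<close> is opposite to the sum over \<open>half_phi1\<close>.\<close>

lemma orthonormal_basis_squares_21:
  assumes dec: "Spin7_decomposition V7 V21" and B: "orthonormal_basis V21 B"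
  shows "Phi_Spin7 = (2/3) *\<^sub>R (\<Sum>b\<in>B. b \<and>\<^sub>w b)"
proof -
  have V7: "V7 = span half_phi1" by (rule Spin7_decomposition_unique[OF dec])
  have orth: "v \<bullet> w = 0" if "v \<in> half_phi1" "w \<in> B" for v w
    using dec B that V7 span_base
    by (fastforce simp: Spin7_decomposition_def orthonormal_basis_def orthogonal_def)
  then have orth': "w \<bullet> v = 0" if "v \<in> half_phi1" "w \<in> B" for v w
    using that by (simp add: inner_commute)
  have norm: "\<forall>b\<in>B. norm b = 1" and finB: "finite B"
    using B orthonormal_independent independent_imp_finite by (auto simp: orthonormal_basis_def)
  \<comment> \<open>A common element would be orthogonal to itself and yet have norm 1.\<close>
  have disj: "half_phi1 \<inter> B = {}"
  proof -
    have "b \<notin> half_phi1" if "b \<in> B" for b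
      using orth[of b b] norm that by (force simp: norm_eq_sqrt_inner)
    then show ?thesis by blast
  qed
  have "span (half_phi1 \<union> B) = Lambda2"
    using dec B V7 by (auto simp: span_Un Spin7_decomposition_def orthonormal_basis_def)
  then have "orthonormal_basis Lambda2 (half_phi1 \<union> B)"
    using half_phi1_orthonormal B orth orth' span_superset[of "half_phi1 \<union> B"]
    by (auto simp: orthonormal_basis_def pairwise_def orthogonal_def)
  note squares = orthonormal_basis_squares[OF this orthonormal_basis_Lambda2]
  have "inj_on pair_form (set pairs8)"
    by (rule inj_onI) (metis inner_pair_form zero_neq_one)
  with squares have "(\<Sum>b\<in>half_phi1 \<union> B. b \<and>\<^sub>w b) = (\<Sum>p\<in>set pairs8. pair_form p \<and>\<^sub>w pair_form p)"
    by (simp add: sum.reindex)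
  then have "(\<Sum>b\<in>half_phi1. b \<and>\<^sub>w b) + (\<Sum>b\<in>B. b \<and>\<^sub>w b) = 0"
    using disj finB by (simp add: sum.union_disjoint half_phi1_def sum_pair_form_squares)
  then have "(\<Sum>b\<in>B. b \<and>\<^sub>w b) = (3/2) *\<^sub>R Phi_Spin7"
    by (simp add: sum_half_phi1_squares)
  then show ?thesis by simp
qed

theorem proposition4p3:
  shows "Phi_Spin7 = - (1/6) *\<^sub>R (\<Sum>\<alpha>\<in>UNIV. phi1 \<alpha> \<and>\<^sub>w phi1 \<alpha>) \<and>
    Phi_Spin7 = (1/6) *\<^sub>R
      (\<Sum>(\<alpha>, \<beta>)\<in>{(\<alpha>, \<beta>). unit_index \<alpha> < unit_index \<beta>}. phi2 \<alpha> \<beta> \<and>\<^sub>w phi2 \<alpha> \<beta>) \<and>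
    Phi_Spin7 = (1/6) *\<^sub>R Rep_even_form (tau2 phi_matrix) \<and>
    (\<forall>V7 V21. Spin7_decomposition V7 V21 \<longrightarrow>
      (\<forall>V\<in>{V7, V21}. \<exists>c. c \<noteq> 0 \<and>
        (\<forall>B. orthonormal_basis V B \<longrightarrow> Phi_Spin7 = c *\<^sub>R (\<Sum>b\<in>B. b \<and>\<^sub>w b))))"
proof (intro conjI)
  show "Phi_Spin7 = - (1/6) *\<^sub>R (\<Sum>\<alpha>\<in>UNIV. phi1 \<alpha> \<and>\<^sub>w phi1 \<alpha>)"
    by (simp add: sum_phi1_squares)
  show 2: "Phi_Spin7 = (1/6) *\<^sub>R
      (\<Sum>(\<alpha>, \<beta>)\<in>{(\<alpha>, \<beta>). unit_index \<alpha> < unit_index \<beta>}. phi2 \<alpha> \<beta> \<and>\<^sub>w phi2 \<alpha> \<beta>)"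
    by (simp add: sum_phi2_squares)
  show "Phi_Spin7 = (1/6) *\<^sub>R Rep_even_form (tau2 phi_matrix)"
    by (simp add: tau2_phi_matrix[OF phi2_anticommute] sum_phi2_squares)
  show "\<forall>V7 V21. Spin7_decomposition V7 V21 \<longrightarrow>
      (\<forall>V\<in>{V7, V21}. \<exists>c. c \<noteq> 0 \<and>
        (\<forall>B. orthonormal_basis V B \<longrightarrow> Phi_Spin7 = c *\<^sub>R (\<Sum>b\<in>B. b \<and>\<^sub>w b)))"
  proof (intro allI impI ballI)
    fix V7 V21 V assume dec: "Spin7_decomposition V7 V21" and "V \<in> {V7, V21}"
    then consider "V = V7" | "V = V21" by blast
    then show "\<exists>c. c \<noteq> 0 \<and> (\<forall>B. orthonormal_basis V B \<longrightarrow> Phi_Spin7 = c *\<^sub>R (\<Sum>b\<in>B. b \<and>\<^sub>w b))"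
    proof cases
      case 1
      then show ?thesis
        using orthonormal_basis_squares_7[OF dec] by (intro exI[where x = "- (2/3)"]) simp
    next
      case 2
      then show ?thesis
        using orthonormal_basis_squares_21[OF dec] by (intro exI[where x = "2/3"]) simp
    qed
  qed
qed

end
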